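(* Let $2\le k\le r$ be integers, and let $\mathcal H=(H_1,\dots,H_t)$, $t\ge1$, be a family of distinct $r$-dimensional subspaces of a vector space over an arbitrary field. Put $\mathfrak O=\dim\sum_iH_i$, $\mathfrak E=\dim\sum_i\Lambda^kH_i$, $\beta=\frac1r\binom rk$, and write $\Phi=tr-\mathfrak O=ar+b$ with integers $a\ge 0$ and $0\le b<r$. Then $$\mathfrak E\ge (t-a)\binom rk-\binom bk .$$ If $\Phi>0$ and $b=0$, then $$\mathfrak E\ge (t-a)\binom rk+\binom{r-1}{k-1}.$$ Consequently $\mathfrak E\ge\beta\,\mathfrak O$, and, whenever the ordinary sum $H_1+\cdots+H_t$ is not direct, $\mathfrak E\ge\beta(\mathfrak O+1)$. Equality $\mathfrak E=\beta\,\mathfrak O$ holds exactly when the sum $H_1+\cdots+H_t$ is direct, and the one-unit gap is sharp: there are families with non-direct ordinary sum for which $\mathfrak E=\beta(\mathfrak O+1)$.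
   Context: The exterior powers $\Lambda^kH_i$ are regarded as subspaces of $\Lambda^kV$, where $V$ is the ambient vector space, and $\sum_i\Lambda^kH_i$ is their sum there. Binomial coefficients $\binom bk$ with $b<k$ are $0$. *)

theory Defs
  imports Complex_Main "HOL-Library.Function_Algebras" "HOL-Library.Set_Algebras"
begin

text \<open>Sums \<open>\<Sum>i<t. H i\<close> of subspaces are the Minkowski sums of \<^theory>\<open>HOL-Library.Set_Algebras\<close>.\<close>

definition fun_scale :: "'f::field \<Rightarrow> ('x \<Rightarrow> 'f) \<Rightarrow> ('x \<Rightarrow> 'f)"
  where "fun_scale c f = (\<lambda>x. c * f x)"

text \<open>A map on \<open>k\<close>-tuples is represented by a function on lists, of which only the values on
  lists of length \<open>k\<close> matter.\<close>

definition alternating_map ::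
    "('f::field \<Rightarrow> 'v::ab_group_add \<Rightarrow> 'v) \<Rightarrow> ('f \<Rightarrow> 'w::ab_group_add \<Rightarrow> 'w) \<Rightarrow> nat \<Rightarrow>
     ('v list \<Rightarrow> 'w) \<Rightarrow> bool"
  where "alternating_map scale scale' k g \<longleftrightarrow>
    (\<forall>vs i. length vs = k \<and> i < k \<longrightarrow> Vector_Spaces.linear scale scale' (\<lambda>x. g (vs[i := x]))) \<and>
    (\<forall>vs. length vs = k \<and> \<not> distinct vs \<longrightarrow> g vs = 0)"

text \<open>
  The exterior power is realised inside the dual of the space of alternating \<open>k\<close>-forms:
  \<open>v\<^sub>1 \<and> \<dots> \<and> v\<^sub>k\<close> is the evaluation functional \<open>\<omega> \<mapsto> \<omega>(v\<^sub>1, \<dots>, v\<^sub>k)\<close> (extended by \<open>0\<close> to functions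
  that are not alternating forms), and the \<open>k\<close>-th exterior power of \<open>V\<close> is the span of these elements.
  This is valid over every field and in every dimension; the lemmas \<open>alternating_map_wedge\<close>,
  \<open>ext_power_universal\<close> and \<open>ext_power_universal_unique\<close> below establish the universal property.
  For a subspace \<open>S\<close>, \<open>ext_power scale k S\<close> is the image in the exterior power of the ambient space
  of the exterior power of \<open>S\<close>.
\<close>

definition wedge ::
    "('f::field \<Rightarrow> 'v::ab_group_add \<Rightarrow> 'v) \<Rightarrow> nat \<Rightarrow> 'v list \<Rightarrow> (('v list \<Rightarrow> 'f) \<Rightarrow> 'f)"
  where "wedge scale k vs = (\<lambda>\<omega>. if alternating_map scale (*) k \<omega> then \<omega> vs else 0)"

definition ext_power ::
    "('f::field \<Rightarrow> 'v::ab_group_add \<Rightarrow> 'v) \<Rightarrow> nat \<Rightarrow> 'v set \<Rightarrow> (('v list \<Rightarrow> 'f) \<Rightarrow> 'f) set"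
  where "ext_power scale k S =
    module.span fun_scale {wedge scale k vs | vs. length vs = k \<and> set vs \<subseteq> S}"

text \<open>In the library, an infinite-dimensional space has dimension \<open>0\<close>; for \<open>r > 0\<close> the condition on
  the dimension therefore includes finite-dimensionality.\<close>

definition subspace_family ::
    "('f::field \<Rightarrow> 'v::ab_group_add \<Rightarrow> 'v) \<Rightarrow> nat \<Rightarrow> nat \<Rightarrow> (nat \<Rightarrow> 'v set) \<Rightarrow> bool"
  where "subspace_family scale r t H \<longleftrightarrow>
    1 \<le> t \<and> inj_on H {..<t} \<and>
    (\<forall>i<t. module.subspace scale (H i) \<and> vector_space.dim scale (H i) = r)"

definition direct_sum :: "nat \<Rightarrow> (nat \<Rightarrow> 'v::ab_group_add set) \<Rightarrow> bool"
  where "direct_sum t H \<longleftrightarrow>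
    (\<forall>x y. (\<forall>i<t. x i \<in> H i) \<and> (\<forall>i<t. y i \<in> H i) \<and> (\<Sum>i<t. x i) = (\<Sum>i<t. y i) \<longrightarrow>
      (\<forall>i<t. x i = y i))"

definition ord_dim ::
    "('f::field \<Rightarrow> 'v::ab_group_add \<Rightarrow> 'v) \<Rightarrow> nat \<Rightarrow> (nat \<Rightarrow> 'v set) \<Rightarrow> nat"
  where "ord_dim scale t H = vector_space.dim scale (\<Sum>i<t. H i)"

definition ext_dim ::
    "('f::field \<Rightarrow> 'v::ab_group_add \<Rightarrow> 'v) \<Rightarrow> nat \<Rightarrow> nat \<Rightarrow> (nat \<Rightarrow> 'v set) \<Rightarrow> nat"
  where "ext_dim scale k t H = vector_space.dim fun_scale (\<Sum>i<t. ext_power scale k (H i))"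


lemma vector_space_fun_scale: "vector_space (fun_scale :: 'f::field \<Rightarrow> ('x \<Rightarrow> 'f) \<Rightarrow> _)"
  by unfold_locales (auto simp: fun_scale_def fun_eq_iff algebra_simps)

lemma vector_space_field: "vector_space ((*) :: 'f::field \<Rightarrow> 'f \<Rightarrow> 'f)"
  by unfold_locales (auto simp: algebra_simps)

lemma alternating_map_wedge:
  assumes "vector_space scale"
  shows "alternating_map scale fun_scale k (wedge scale k)"
proof -
  have "Vector_Spaces.linear scale fun_scale (\<lambda>x. wedge scale k (vs[i := x]))"
    if "length vs = k" "i < k" for vs i
  proof -
    have hom: "module_hom scale (*) (\<lambda>x. \<omega> (vs[i := x]))"
      if "alternating_map scale (*) k \<omega>" for \<omega>
      using that \<open>length vs = k\<close> \<open>i < k\<close>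
      by (auto simp: alternating_map_def module_hom_iff_linear)
    then have
      "\<omega> (vs[i := x + y]) = \<omega> (vs[i := x]) + \<omega> (vs[i := y])"
      "\<omega> (vs[i := scale c x]) = c * \<omega> (vs[i := x])"
      if "alternating_map scale (*) k \<omega>" for \<omega> x y c
      using module_hom.add[OF hom[OF that]] module_hom.scale[OF hom[OF that]] by blast+
    then show ?thesis
      unfolding Vector_Spaces.linear_iff using assms vector_space_fun_scale
      by (auto simp: wedge_def fun_scale_def fun_eq_iff)
  qed
  moreover have "wedge scale k vs = 0" if "length vs = k" "\<not> distinct vs" for vs
    using that by (auto simp: wedge_def alternating_map_def fun_eq_iff)
  ultimately show ?thesis
    by (auto simp: alternating_map_def)
qed

theorem ext_power_universal:
  fixes scale :: "'f::field \<Rightarrow> 'v::ab_group_add \<Rightarrow> 'v"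
    and scale' :: "'f \<Rightarrow> 'w::ab_group_add \<Rightarrow> 'w"
  assumes "vector_space scale" "vector_space scale'" and g: "alternating_map scale scale' k g"
  shows "\<exists>L. Vector_Spaces.linear fun_scale scale' L \<and>
    (\<forall>vs. length vs = k \<longrightarrow> L (wedge scale k vs) = g vs)"
proof -
  interpret U: vector_space "fun_scale :: 'f \<Rightarrow> (('v list \<Rightarrow> 'f) \<Rightarrow> 'f) \<Rightarrow> _"
    by (rule vector_space_fun_scale)
  interpret UW: vector_space_pair "fun_scale :: 'f \<Rightarrow> (('v list \<Rightarrow> 'f) \<Rightarrow> 'f) \<Rightarrow> _" scale'
    by (intro vector_space_pair.intro vector_space_fun_scale assms)
  interpret WF: vector_space_pair scale' "(*) :: 'f \<Rightarrow> 'f \<Rightarrow> 'f"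
    by (intro vector_space_pair.intro vector_space_field assms)
  define W where "W = {wedge scale k vs | vs. length vs = k}"
  obtain B where B: "B \<subseteq> W" "U.independent B" "W \<subseteq> U.span B"
    using U.maximal_independent_subset by blast
  obtain \<rho> where \<rho>: "length (\<rho> b) = k \<and> wedge scale k (\<rho> b) = b" if "b \<in> B" for b
  proof -
    have "\<forall>b\<in>B. \<exists>vs. length vs = k \<and> wedge scale k vs = b"
      using B(1) by (auto simp: W_def)
    then show thesis using that by metis
  qed
  obtain L where L: "Vector_Spaces.linear fun_scale scale' L" "\<forall>b\<in>B. L b = g (\<rho> b)"
    using UW.linear_independent_extend[OF B(2), of "\<lambda>b. g (\<rho> b)"] by blast
  interpret L: Vector_Spaces.linear fun_scale scale' L by (rule L(1))
  have "L (wedge scale k vs) = g vs" if vs: "length vs = k" for vs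
  proof (rule ccontr)
    assume neq: "L (wedge scale k vs) \<noteq> g vs"
    have "wedge scale k vs \<in> U.span B"
      using B(3) vs by (auto simp: W_def)
    then obtain T c where T: "finite T" "T \<subseteq> B"
      and eq: "wedge scale k vs = (\<Sum>b\<in>T. fun_scale (c b) b)"
      unfolding U.span_explicit by blast
    define d where "d = g vs - (\<Sum>b\<in>T. scale' (c b) (g (\<rho> b)))"
    have "L (wedge scale k vs) = (\<Sum>b\<in>T. scale' (c b) (g (\<rho> b)))"
      using T L(2) by (auto simp: eq L.sum L.scale intro!: sum.cong)
    with neq have "d \<noteq> 0" by (auto simp: d_def)
    then obtain \<phi> where \<phi>: "Vector_Spaces.linear scale' (*) \<phi>" "\<phi> d = 1"
      using WF.linear_independent_extend[of "{d}" "\<lambda>_. 1"] by auto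
    interpret \<phi>: Vector_Spaces.linear scale' "(*)" \<phi> by (rule \<phi>(1))
    have alt: "alternating_map scale (*) k (\<phi> \<circ> g)"
      using g Vector_Spaces.linear_compose[OF _ \<phi>(1), of scale]
      by (auto simp: alternating_map_def o_def \<phi>.zero)
    have ev: "(\<Sum>b\<in>T. fun_scale (c b) b) \<omega> = (\<Sum>b\<in>T. c b * b \<omega>)" for \<omega>
      using T(1) by (induction rule: finite_induct) (auto simp: fun_scale_def)
    have b: "b (\<phi> \<circ> g) = \<phi> (g (\<rho> b))" if "b \<in> T" for b
    proof -
      have "b = wedge scale k (\<rho> b)" using \<rho> T that by auto
      then have "b (\<phi> \<circ> g) = wedge scale k (\<rho> b) (\<phi> \<circ> g)" by simp
      then show ?thesis using alt by (simp add: wedge_def)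
    qed
    have "\<phi> (g vs) = wedge scale k vs (\<phi> \<circ> g)"
      using alt by (simp add: wedge_def)
    also have "\<dots> = (\<Sum>b\<in>T. c b * \<phi> (g (\<rho> b)))"
      unfolding eq ev using b by (intro sum.cong) auto
    also have "\<dots> = \<phi> (\<Sum>b\<in>T. scale' (c b) (g (\<rho> b)))"
      by (simp add: \<phi>.sum \<phi>.scale)
    finally have "\<phi> d = 0" by (simp add: d_def \<phi>.diff)
    with \<phi>(2) show False by simp
  qed
  with L(1) show ?thesis by blast
qed

lemma ext_power_universal_unique:
  fixes scale :: "'f::field \<Rightarrow> 'v::ab_group_add \<Rightarrow> 'v"
    and scale' :: "'f \<Rightarrow> 'w::ab_group_add \<Rightarrow> 'w"
  assumes "Vector_Spaces.linear fun_scale scale' L" "Vector_Spaces.linear fun_scale scale' L'"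
    and "\<And>vs. length vs = k \<Longrightarrow> L (wedge scale k vs) = L' (wedge scale k vs)"
    and "x \<in> ext_power scale k UNIV"
  shows "L x = L' x"
proof -
  interpret L: Vector_Spaces.linear fun_scale scale' L by (rule assms)
  interpret P: vector_space_pair "fun_scale :: 'f \<Rightarrow> (('v list \<Rightarrow> 'f) \<Rightarrow> 'f) \<Rightarrow> _" scale'
    by (intro vector_space_pair.intro L.vs1.vector_space_axioms L.vs2.vector_space_axioms)
  show ?thesis
    by (rule P.linear_eq_on[OF assms(1,2) assms(4)[unfolded ext_power_def]]) (use assms(3) in blast)
qed

end

theory Submission
  imports Defs "Jordan_Normal_Form.Determinant"
begin

text \<open>
  Let \<open>S\<^sub>n = H\<^sub>0 + \<dots> + H\<^sub>n\<^sub>-\<^sub>1\<close> and \<open>d\<^sub>n = dim (S\<^sub>n \<inter> H\<^sub>n)\<close>, so that \<open>\<Phi>\<close> is the sum of the \<open>d\<^sub>n\<close>.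
  Since the exterior powers of the earlier subspaces lie in \<open>\<Lambda>\<^sup>k S\<^sub>n\<close>, which meets \<open>\<Lambda>\<^sup>k H\<^sub>n\<close> in
  \<open>\<Lambda>\<^sup>k (S\<^sub>n \<inter> H\<^sub>n)\<close>, adjoining \<open>H\<^sub>n\<close> raises the dimension by at least \<open>C(r,k) - C(d\<^sub>n,k)\<close>. Convexity of
  \<open>d \<mapsto> C(d,k)\<close> then yields the first bound, and also the second one if some \<open>d\<^sub>n\<close> differs from
  \<open>0\<close> and \<open>r\<close>. Otherwise take the first \<open>j\<close> with \<open>d\<^sub>j = r\<close>: the earlier subspaces form a direct sum
  containing \<open>K = H\<^sub>j\<close>, and for some \<open>l < j\<close> neither \<open>P = H\<^sub>l\<close> nor the sum \<open>Q\<close> of the other earlier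
  subspaces contains \<open>K\<close>. The dual of \<open>K\<close> then has a basis of functionals vanishing on \<open>P\<close> or on \<open>Q\<close>
  in which both kinds occur; the determinants of \<open>k\<close> of them that use both kinds annihilate every
  earlier exterior power, which gives \<open>C(r-1,k-1)\<close> extra dimensions.
\<close>

subsection \<open>Bases and dual functionals\<close>

interpretation fs: vector_space "fun_scale :: 'f::field \<Rightarrow> ('x \<Rightarrow> 'f) \<Rightarrow> _"
  by (rule vector_space_fun_scale)

context vector_space
begin

text \<open>\<open>C\<close> may be infinite, since it will be a basis of an arbitrary subspace. A
  new vector of \<open>X\<close> lying in \<open>span (C \<union> X)\<close> would differ by an
  element of \<open>span X\<close> from a vector of \<open>span C\<close>, which the trivial
  intersection forces to be 0.\<close>

lemma independent_Un_finite:
  assumes "finite X" "independent C" "independent X" "span C \<inter> span X \<subseteq> {0}"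
  shows "independent (C \<union> X)"
  using assms
proof (induction X rule: finite_induct)
  case (insert x X)
  have ind: "independent X" "x \<notin> span X"
    using insert.prems(2) insert.hyps(2) by (simp_all add: independent_insert)
  have "span X \<subseteq> span (insert x X)" by (rule span_mono) auto
  with insert ind have IH: "independent (C \<union> X)" by blast
  have "x \<notin> span (C \<union> X)"
  proof
    assume "x \<in> span (C \<union> X)"
    then obtain c y where cy: "x = c + y" "c \<in> span C" "y \<in> span X"
      unfolding span_Un by blast
    have "x - y \<in> span (insert x X)"
      by (rule span_diff[OF span_base]) (use cy(3) \<open>span X \<subseteq> span (insert x X)\<close> in auto)
    then have "c = 0" using cy(1,2) insert.prems(3) by (auto simp: algebra_simps)
    with cy ind show False by simp
  qed
  with IH show ?case by (simp add: independent_insertI)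
qed simp

lemma disjoint_of_trivial_Int:
  assumes "independent X" "span C \<inter> span X \<subseteq> {0}"
  shows "C \<inter> X = {}"
proof -
  have "0 \<notin> X" using assms(1) dependent_zero by blast
  moreover have "C \<inter> X \<subseteq> span C \<inter> span X" using span_superset by blast
  ultimately show ?thesis using assms(2) by auto
qed

lemma finite_basis_exists:
  assumes "V \<subseteq> span W" "finite W"
  obtains B where "finite B" "B \<subseteq> V" "independent B" "V \<subseteq> span B" "card B = dim V"
proof -
  obtain B where B: "B \<subseteq> V" "independent B" "V \<subseteq> span B" "card B = dim V"
    using basis_exists by blast
  moreover have "finite B"
    using independent_span_bound[OF assms(2) B(2)] B(1) assms(1) by blast
  ultimately show ?thesis using that by blast
qed

lemma card_le_dim:
  assumes "independent B" "B \<subseteq> V" "V \<subseteq> span W" "finite W"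
  shows "card B \<le> dim V"
proof -
  obtain C where C: "finite C" "C \<subseteq> V" "independent C" "V \<subseteq> span C" "card C = dim V"
    using finite_basis_exists assms(3,4) .
  show ?thesis
    using independent_span_bound[OF C(1) assms(1)] assms(2) C(4,5) by auto
qed

text \<open>An infinite basis has \<open>card\<close> 0, so a positive dimension certifies a finite
  spanning set.\<close>

lemma finite_span_of_dim_pos:
  assumes "0 < dim V"
  obtains W where "finite W" "V \<subseteq> span W"
proof -
  obtain B where B: "V \<subseteq> span B" "card B = dim V"
    using basis_exists by blast
  with assms have "finite B" by (intro card_ge_0_finite) simp
  with B show ?thesis using that by blast
qed

text \<open>A basis of \<open>S\<close> stays independent when \<open>X\<close> is adjoined, so the
  values 0 on it and Kronecker deltas on \<open>X\<close> extend to linear functionals on the whole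
  space.\<close>

lemma dual_functionals:
  assumes "finite X" "independent X" "subspace S" "span X \<inter> S \<subseteq> {0}"
  obtains \<phi> where "\<And>a. Vector_Spaces.linear scale (*) (\<phi> a)"
    "\<And>a b. a \<in> X \<Longrightarrow> b \<in> X \<Longrightarrow> \<phi> a b = (if a = b then 1 else 0)"
    "\<And>a s. a \<in> X \<Longrightarrow> s \<in> S \<Longrightarrow> \<phi> a s = 0"
proof -
  interpret P: vector_space_pair scale "(*) :: 'a \<Rightarrow> 'a \<Rightarrow> 'a"
    by (intro vector_space_pair.intro vector_space_field vector_space_axioms)
  obtain C where C: "C \<subseteq> S" "independent C" "S \<subseteq> span C"
    by (rule basis_exists)
  have spC: "span C = S" using C assms(3) by (simp add: span_subspace)
  have ind: "independent (C \<union> X)"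
    using independent_Un_finite[of X C] assms C(2) spC by blast
  have dis: "C \<inter> X = {}"
    using disjoint_of_trivial_Int[of X C] assms spC by blast
  have "\<exists>f. Vector_Spaces.linear scale (*) f \<and> (\<forall>b\<in>C \<union> X. f b = (if a = b then 1 else 0))" for a
    by (rule P.linear_independent_extend[OF ind])
  then obtain \<phi> where \<phi>: "\<And>a. Vector_Spaces.linear scale (*) (\<phi> a)"
    "\<And>a b. b \<in> C \<union> X \<Longrightarrow> \<phi> a b = (if a = b then 1 else 0)"
    by metis
  have "\<phi> a s = 0" if "a \<in> X" "s \<in> S" for a s
  proof -
    interpret \<phi>: Vector_Spaces.linear scale "(*)" "\<phi> a" by (rule \<phi>(1))
    have "\<phi> a b = 0" if "b \<in> C" for b
      using \<phi>(2)[of b a] dis that \<open>a \<in> X\<close> by auto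
    then show ?thesis
      using \<phi>.eq_0_on_span[of C s] that(2) spC by blast
  qed
  moreover have "\<phi> a b = (if a = b then 1 else 0)" if "b \<in> X" for a b
    using \<phi>(2) that by blast
  ultimately show ?thesis using that \<phi>(1) by blast
qed

text \<open>A basis \<open>D\<close> of \<open>S \<inter> H\<close> is extended to one of
  \<open>H\<close>; the added vectors \<open>B\<close> span a complement of
  \<open>S \<inter> H\<close> in \<open>H\<close>, which therefore meets \<open>S\<close> only in
  0.\<close>

lemma relative_basis:
  assumes "subspace S" "subspace H" "H \<subseteq> span W" "finite W"
  obtains D B where "finite D" "finite B" "D \<inter> B = {}" "independent (D \<union> B)"
    "span D = S \<inter> H" "span (D \<union> B) = H" "span B \<inter> S \<subseteq> {0}"
proof -
  obtain D where D: "finite D" "D \<subseteq> S \<inter> H" "independent D" "S \<inter> H \<subseteq> span D"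
    by (rule finite_basis_exists[of "S \<inter> H" W]) (use assms(3,4) in auto)
  obtain E where E: "D \<subseteq> E" "E \<subseteq> H" "independent E" "H \<subseteq> span E"
    by (rule maximal_independent_subset_extend[of D H]) (use D in auto)
  have finE: "finite E"
    using independent_span_bound[OF assms(4) E(3)] E(2) assms(3) by blast
  define B where "B = E - D"
  have DB: "D \<union> B = E" "D \<inter> B = {}" using E by (auto simp: B_def)
  have spD: "span D = S \<inter> H"
    using D assms by (simp add: span_subspace subspace_inter)
  have spE: "span E = H" using E assms by (simp add: span_subspace)
  have "x = 0" if x: "x \<in> span B" "x \<in> S" for x
  proof -
    have "x \<in> H" using x(1) spE span_mono[of B E] by (auto simp: B_def)
    with x spD have "x \<in> span D" by blast
    \<comment> \<open>The coordinates of \<open>x\<close> in the basis \<open>E\<close> are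
      supported on \<open>B\<close> and also on \<open>D\<close>, which are disjoint.\<close>
    have "representation E x = representation B x"
      using E x by (intro representation_extend) (auto simp: B_def)
    moreover have "representation E x = representation D x"
      using E \<open>x \<in> span D\<close> by (intro representation_extend) auto
    ultimately have "representation D x b = 0" for b
      using representation_ne_zero[of B x b] representation_ne_zero[of D x b] DB(2) by auto
    then show "x = 0"
      using sum_representation_eq[OF D(3) \<open>x \<in> span D\<close> D(1)] by simp
  qed
  then have "span B \<inter> S \<subseteq> {0}" by auto
  then show ?thesis
    using that[of D B] D(1) finE DB spD spE E(3) finite_subset[of B E] by (simp add: B_def)
qed

lemma subspace_set_plus:
  assumes "subspace S" "subspace T"
  shows "subspace (S + T)"
proof -
  have "S + T = {x + y |x y. x \<in> S \<and> y \<in> T}" by (auto simp: set_plus_def)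
  then show ?thesis using subspace_sums[OF assms] by simp
qed

end

subsection \<open>Determinant forms and exterior powers\<close>

text \<open>Wedges take lists, while the spanning elements of an exterior power are indexed by
  \<open>k\<close>-subsets; this fixes one arbitrary ordering of each.\<close>

definition enum_set :: "'a set \<Rightarrow> 'a list"
  where "enum_set A = (SOME xs. distinct xs \<and> set xs = A)"

lemma distinct_enum_set:
  assumes "finite A"
  shows "distinct (enum_set A) \<and> set (enum_set A) = A"
proof -
  obtain xs where "distinct xs \<and> set xs = A" using finite_distinct_list[OF assms] by blast
  then show ?thesis unfolding enum_set_def by (rule someI)
qed

text \<open>The wedge product of the functionals \<open>\<phi>s\<close>, read as an alternating
  form. Elements of exterior powers are tested by evaluation at such forms.\<close>

definition det_form :: "nat \<Rightarrow> ('v \<Rightarrow> 'f::field) list \<Rightarrow> 'v list \<Rightarrow> 'f"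
  where "det_form k \<phi>s vs = det (mat k k (\<lambda>(i, j). (\<phi>s ! j) (vs ! i)))"

lemma det_form_eq_0:
  assumes "length \<phi>s = k" "\<phi> \<in> set \<phi>s" "length vs = k" "\<And>v. v \<in> set vs \<Longrightarrow> \<phi> v = 0"
  shows "det_form k \<phi>s vs = 0"
proof -
  obtain j where j: "j < k" "\<phi>s ! j = \<phi>" using assms(1,2) by (metis in_set_conv_nth)
  have "det_form k \<phi>s vs = (\<Sum>i<k. mat k k (\<lambda>(i, j). (\<phi>s ! j) (vs ! i)) $$ (i, j) *
      cofactor (mat k k (\<lambda>(i, j). (\<phi>s ! j) (vs ! i))) i j)"
    unfolding det_form_def by (rule laplace_expansion_column) (use j in auto)
  also have "\<dots> = 0"
    using j assms(3,4) by (intro sum.neutral) auto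
  finally show ?thesis .
qed

lemma det_form_dual:
  assumes "length \<phi>s = k" "\<And>i j. i < k \<Longrightarrow> j < k \<Longrightarrow> (\<phi>s ! j) (vs ! i) = (if i = j then 1 else 0)"
  shows "det_form k \<phi>s vs = 1"
proof -
  have "mat k k (\<lambda>(i, j). (\<phi>s ! j) (vs ! i)) = 1\<^sub>m k"
    using assms by (intro eq_matI) auto
  then show ?thesis by (simp add: det_form_def)
qed

text \<open>Laplace expansion along row \<open>i\<close>: the cofactors do not see that row, so the
  right-hand side is linear in \<open>x\<close> when the functionals are.\<close>

lemma det_form_update:
  assumes "length vs = k" "i < k"
  shows "det_form k \<phi>s (vs[i := x]) =
    (\<Sum>j<k. (\<phi>s ! j) x * cofactor (mat k k (\<lambda>(i, j). (\<phi>s ! j) (vs ! i))) i j)"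
proof -
  let ?M = "\<lambda>vs. mat k k (\<lambda>(i, j). (\<phi>s ! j) (vs ! i))"
  have "det_form k \<phi>s (vs[i := x]) = (\<Sum>j<k. ?M (vs[i := x]) $$ (i, j) * cofactor (?M (vs[i := x])) i j)"
    unfolding det_form_def by (rule laplace_expansion_row) (use assms in auto)
  also have "\<dots> = (\<Sum>j<k. (\<phi>s ! j) x * cofactor (?M vs) i j)"
  proof (rule sum.cong)
    fix j assume "j \<in> {..<k}"
    have "mat_delete (?M (vs[i := x])) i j = mat_delete (?M vs) i j"
      using assms by (intro eq_matI) (auto simp: mat_delete_def)
    then show "?M (vs[i := x]) $$ (i, j) * cofactor (?M (vs[i := x])) i j =
        (\<phi>s ! j) x * cofactor (?M vs) i j"
      using assms \<open>j \<in> {..<k}\<close> by (simp add: cofactor_def)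
  qed simp
  finally show ?thesis .
qed

lemma alternating_map_det_form:
  fixes \<phi>s :: "('v::ab_group_add \<Rightarrow> 'f::field) list"
  assumes "vector_space scale" "length \<phi>s = k"
    and lin: "\<And>\<phi>. \<phi> \<in> set \<phi>s \<Longrightarrow> Vector_Spaces.linear scale (*) \<phi>"
  shows "alternating_map scale (*) k (det_form k \<phi>s)"
  unfolding alternating_map_def
proof (intro conjI allI impI; elim conjE)
  fix vs :: "'v list" and i
  assume vs: "length vs = k" "i < k"
  have "(\<phi>s ! j) (x + y) = (\<phi>s ! j) x + (\<phi>s ! j) y" "(\<phi>s ! j) (scale c x) = c * (\<phi>s ! j) x"
    if "j < k" for j x y c
    using lin[of "\<phi>s ! j"] that assms(2) unfolding Vector_Spaces.linear_iff by auto
  then show "Vector_Spaces.linear scale (*) (\<lambda>x. det_form k \<phi>s (vs[i := x]))"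
    unfolding Vector_Spaces.linear_iff det_form_update[OF vs] using assms(1) vector_space_field
    by (auto simp: algebra_simps sum.distrib sum_distrib_left intro!: sum.cong)
next
  fix vs :: "'v list"
  assume vs: "length vs = k" "\<not> distinct vs"
  then obtain i j where ij: "i < k" "j < k" "i \<noteq> j" "vs ! i = vs ! j"
    by (auto simp: distinct_conv_nth)
  show "det_form k \<phi>s vs = 0"
    unfolding det_form_def
    by (rule det_identical_rows[of _ k i j]) (use ij in \<open>auto intro!: eq_vecI\<close>)
qed

context vector_space
begin

lemma wedge_eval_det_form:
  assumes "length \<phi>s = k" "\<And>\<phi>. \<phi> \<in> set \<phi>s \<Longrightarrow> Vector_Spaces.linear scale (*) \<phi>"
  shows "wedge scale k vs (det_form k \<phi>s) = det_form k \<phi>s vs"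
  using alternating_map_det_form[OF vector_space_axioms assms] by (simp add: wedge_def)

lemma subspace_ext_power: "fs.subspace (ext_power scale k X)"
  unfolding ext_power_def by (rule fs.subspace_span)

lemma wedge_in_ext_power: "length vs = k \<Longrightarrow> set vs \<subseteq> X \<Longrightarrow> wedge scale k vs \<in> ext_power scale k X"
  unfolding ext_power_def by (rule fs.span_base) blast

lemma fs_subspace_eval_zero: "fs.subspace {f. f x = 0}"
  by (auto intro!: fs.subspaceI simp: fun_scale_def)

text \<open>Evaluation at a fixed form is linear, so it suffices to look at wedges of vectors of
  \<open>X\<close>, for which the determinant has a zero column.\<close>

lemma ext_power_eval_eq_0:
  assumes "f \<in> ext_power scale k X" "length \<phi>s = k" "\<phi> \<in> set \<phi>s" "\<And>x. x \<in> X \<Longrightarrow> \<phi> x = 0"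
  shows "f (det_form k \<phi>s) = 0"
proof -
  have "ext_power scale k X \<subseteq> {f. f (det_form k \<phi>s) = 0}"
    unfolding ext_power_def
  proof (rule fs.span_minimal)
    show "{wedge scale k vs | vs. length vs = k \<and> set vs \<subseteq> X} \<subseteq> {f. f (det_form k \<phi>s) = 0}"
      using det_form_eq_0[OF assms(2,3)] assms(4) by (auto simp: wedge_def subset_iff)
  qed (rule fs_subspace_eval_zero)
  with assms(1) show ?thesis by blast
qed

lemma wedge_linear:
  assumes "length vs = k" "i < k"
  shows "Vector_Spaces.linear scale fun_scale (\<lambda>x. wedge scale k (vs[i := x]))"
  using alternating_map_wedge[OF vector_space_axioms, of k] assms by (simp add: alternating_map_def)

lemma wedge_not_distinct:
  assumes "length vs = k" "\<not> distinct vs"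
  shows "wedge scale k vs = 0"
  using alternating_map_wedge[OF vector_space_axioms, of k] assms by (simp add: alternating_map_def)

text \<open>Polarisation: expanding \<open>h (x + y) (x + y) = 0\<close>, where \<open>h\<close>
  leaves the two entries free, keeps only the mixed terms. This works in every
  characteristic.\<close>

lemma wedge_swap:
  assumes "length vs = k" "i < k" "j < k" "i \<noteq> j"
  shows "wedge scale k (vs[i := vs ! j, j := vs ! i]) = - wedge scale k vs"
proof -
  define h where "h x y = wedge scale k (vs[i := x, j := y])" for x y
  have diag: "h x x = 0" for x
    unfolding h_def
  proof (rule wedge_not_distinct)
    show "\<not> distinct (vs[i := x, j := x])"
      using assms nth_eq_iff_index_eq[of "vs[i := x, j := x]" i j] by (auto simp: nth_list_update)
  qed (use assms in simp)
  have "h x (y + y') = h x y + h x y'" for x y y'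
    using wedge_linear[of "vs[i := x]" k j] assms by (simp add: Vector_Spaces.linear_iff h_def)
  moreover have "h (x + x') y = h x y + h x' y" for x x' y
    using wedge_linear[of "vs[j := y]" k i] assms
    by (simp add: Vector_Spaces.linear_iff h_def list_update_swap[of i j])
  ultimately have "h (x + y) (x + y) = h x x + h x y + (h y x + h y y)" for x y
    by (simp add: add.assoc)
  then have "h x y + h y x = 0" for x y by (simp add: diag)
  from this[of "vs ! j" "vs ! i"] show ?thesis
    using assms by (simp add: h_def eq_neg_iff_add_eq_0)
qed

lemma wedge_permute:
  assumes "p permutes {..<k}"
  shows "length vs = k \<Longrightarrow> wedge scale k (permute_list p vs) \<in> {wedge scale k vs, - wedge scale k vs}"
  using assms finite_lessThan[of k]
proof (induction arbitrary: vs rule: permutes_induct)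
  case id
  then show ?case by simp
next
  case (swap a b p)
  have "permute_list (transpose a b \<circ> p) vs = permute_list p (permute_list (transpose a b) vs)"
    using swap by (intro permute_list_compose) auto
  moreover have "permute_list (transpose a b) vs = vs[a := vs ! b, b := vs ! a]"
    using swap by (intro nth_equalityI) (auto simp: permute_list_def nth_list_update transpose_def)
  ultimately have eq: "permute_list (transpose a b \<circ> p) vs = permute_list p (vs[a := vs ! b, b := vs ! a])"
    by simp
  have "wedge scale k (vs[a := vs ! b, b := vs ! a]) = - wedge scale k vs"
    using swap by (intro wedge_swap) auto
  then show ?case
    unfolding eq using swap.IH[of "vs[a := vs ! b, b := vs ! a]"] swap.prems by auto
qed

lemma wedge_same_set:
  assumes "distinct vs" "distinct us" "set vs = set us" "length us = k"
  shows "wedge scale k vs \<in> {wedge scale k us, - wedge scale k us}"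
proof -
  have "mset vs = mset us" using assms set_eq_iff_mset_eq_distinct by blast
  then obtain p where "p permutes {..<length us}" "permute_list p us = vs"
    by (rule mset_eq_permutation)
  then show ?thesis using wedge_permute[of p k us] assms(4) by auto
qed

lemma ext_power_span_subset:
  "ext_power scale k (span D) \<subseteq> fs.span {wedge scale k vs | vs. length vs = k \<and> set vs \<subseteq> D}"
    (is "_ \<subseteq> fs.span ?W")
proof -
  \<comment> \<open>Multilinear expansion, one position at a time: the first \<open>n\<close>
    entries range over \<open>span D\<close>, the others already lie in \<open>D\<close>, and
    \<open>n = k\<close> is the claim. The vectors admissible at position \<open>n\<close> form a
    subspace containing \<open>D\<close>.\<close>
  have "wedge scale k vs \<in> fs.span ?W"
    if "n \<le> k" "length vs = k" "set (take n vs) \<subseteq> span D" "set (drop n vs) \<subseteq> D" for n vs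
    using that
  proof (induction n arbitrary: vs)
    case 0
    then show ?case by (auto intro!: fs.span_base)
  next
    case (Suc n)
    interpret w: Vector_Spaces.linear scale fun_scale "\<lambda>x. wedge scale k (vs[n := x])"
      using Suc.prems by (intro wedge_linear) auto
    have "D \<subseteq> {x. wedge scale k (vs[n := x]) \<in> fs.span ?W}"
    proof
      fix x assume "x \<in> D"
      have "set (take n vs) \<subseteq> set (take (Suc n) vs)" by (rule set_take_subset_set_take) simp
      moreover have "drop n (vs[n := x]) = x # drop (Suc n) vs"
        using Suc.prems by (simp add: Cons_nth_drop_Suc[symmetric])
      ultimately show "x \<in> {x. wedge scale k (vs[n := x]) \<in> fs.span ?W}"
        using Suc.prems \<open>x \<in> D\<close> by (intro CollectI Suc.IH) simp_all
    qed
    then have "span D \<subseteq> {x. wedge scale k (vs[n := x]) \<in> fs.span ?W}"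
      by (rule span_minimal) (rule w.subspace_linear_preimage, rule fs.subspace_span)
    moreover have "vs ! n \<in> span D"
      using Suc.prems by (auto simp: take_Suc_conv_app_nth)
    ultimately show ?case by auto
  qed
  from this[of k] show ?thesis
    unfolding ext_power_def by (intro fs.span_minimal fs.subspace_span) auto
qed

text \<open>Repeated entries give 0 and reordering changes at most the sign, so one wedge for each
  \<open>k\<close>-subset of \<open>D\<close> spans.\<close>

lemma dim_ext_power_span_le:
  assumes "finite D"
  shows "fs.dim (ext_power scale k (span D)) \<le> card D choose k"
proof -
  define W where "W = (\<lambda>A. wedge scale k (enum_set A)) ` {A. A \<subseteq> D \<and> card A = k}"
  have "{wedge scale k vs | vs. length vs = k \<and> set vs \<subseteq> D} \<subseteq> fs.span W"
  proof clarify
    fix vs assume vs: "set vs \<subseteq> D" "k = length vs"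
    show "wedge scale (length vs) vs \<in> fs.span W"
    proof (cases "distinct vs")
      case True
      then have c: "card (set vs) = k" using vs by (simp add: distinct_card)
      note enum = distinct_enum_set[OF List.finite_set, of vs]
      then have len: "length (enum_set (set vs)) = k"
        using c distinct_card[of "enum_set (set vs)"] by simp
      have "wedge scale k vs \<in> {wedge scale k (enum_set (set vs)), - wedge scale k (enum_set (set vs))}"
        by (rule wedge_same_set[OF True _ _ len]) (use enum in auto)
      moreover have mem: "wedge scale k (enum_set (set vs)) \<in> fs.span W"
        using vs c by (intro fs.span_base) (auto simp: W_def)
      ultimately have "wedge scale k vs \<in> fs.span W"
        using fs.span_neg[OF mem] by (elim insertE emptyE) (simp_all only:)
      with vs(2) show ?thesis by simp
    next
      case False
      then show ?thesis using wedge_not_distinct[of vs k] vs(2) by (simp add: fs.span_zero)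
    qed
  qed
  then have "ext_power scale k (span D) \<subseteq> fs.span W"
    using ext_power_span_subset[of k D] fs.span_minimal[OF _ fs.subspace_span] by blast
  moreover have "finite W" using assms by (simp add: W_def)
  ultimately have "fs.dim (ext_power scale k (span D)) \<le> card W" by (rule fs.dim_le_card)
  also have "\<dots> \<le> card {A. A \<subseteq> D \<and> card A = k}"
    unfolding W_def using assms by (intro card_image_le) simp
  also have "\<dots> = card D choose k" using n_subsets[OF assms] by simp
  finally show ?thesis .
qed

lemma ext_power_finite_span:
  assumes "X \<subseteq> span D" "finite D"
  obtains W where "finite W" "ext_power scale k X \<subseteq> fs.span W"
proof
  let ?W = "{wedge scale k vs | vs. length vs = k \<and> set vs \<subseteq> D}"
  have "finite {vs. set vs \<subseteq> D \<and> length vs = k}" using assms(2) by (rule finite_lists_length_eq)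
  then have "finite (wedge scale k ` {vs. set vs \<subseteq> D \<and> length vs = k})" by simp
  moreover have "?W = wedge scale k ` {vs. set vs \<subseteq> D \<and> length vs = k}" by auto
  ultimately show "finite ?W" by simp
  have "ext_power scale k X \<subseteq> ext_power scale k (span D)"
    unfolding ext_power_def using assms(1) by (intro fs.span_mono) blast
  then show "ext_power scale k X \<subseteq> fs.span ?W" using ext_power_span_subset by blast
qed

end

text \<open>Evaluating a combination of the \<open>w A\<close> at \<open>\<omega> B\<close> returns
  the coefficient of \<open>w B\<close>. Hence a combination vanishing at all
  \<open>\<omega> B\<close> has only zero coefficients.\<close>

lemma fs_independent_of_dual:
  fixes w :: "'i \<Rightarrow> 'x \<Rightarrow> 'f::field"
  assumes "finite I" "\<And>A B. A \<in> I \<Longrightarrow> B \<in> I \<Longrightarrow> w A (\<omega> B) = (if A = B then 1 else 0)"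
  shows "inj_on w I" "fs.independent (w ` I)"
    "fs.span (w ` I) \<inter> {f. \<forall>A\<in>I. f (\<omega> A) = 0} \<subseteq> {0}"
proof -
  show inj: "inj_on w I"
  proof (rule inj_onI)
    fix A B assume AB: "A \<in> I" "B \<in> I" "w A = w B"
    then have "w A (\<omega> B) = 1" using assms(2)[of B B] by simp
    with AB assms(2)[of A B] show "A = B" by (auto split: if_splits)
  qed
  have ev: "(\<Sum>A\<in>I. fun_scale (c A) (w A)) (\<omega> B) = c B" if "B \<in> I" for B c
  proof -
    have "(\<Sum>A\<in>J. fun_scale (c A) (w A)) x = (\<Sum>A\<in>J. c A * w A x)" if "finite J" for J x
      using that by (induction J rule: finite_induct) (auto simp: fun_scale_def)
    then have "(\<Sum>A\<in>I. fun_scale (c A) (w A)) (\<omega> B) = (\<Sum>A\<in>I. c A * w A (\<omega> B))"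
      using assms(1) by blast
    also have "\<dots> = (\<Sum>A\<in>I. if A = B then c A else 0)"
      using assms(2) that by (intro sum.cong) auto
    finally show ?thesis using assms(1) that by simp
  qed
  show "fs.independent (w ` I)"
  proof (rule fs.independent_if_scalars_zero)
    fix c x assume *: "(\<Sum>x\<in>w ` I. fun_scale (c x) x) = 0" "x \<in> w ` I"
    then obtain B where B: "B \<in> I" "x = w B" by blast
    have "(\<Sum>A\<in>I. fun_scale (c (w A)) (w A)) = 0"
      using *(1) by (simp add: sum.reindex[OF inj])
    with ev[OF B(1), of "\<lambda>A. c (w A)"] B show "c x = 0" by simp
  qed (use assms(1) in simp)
  show "fs.span (w ` I) \<inter> {f. \<forall>A\<in>I. f (\<omega> A) = 0} \<subseteq> {0}"
  proof clarsimp
    fix f assume f: "f \<in> fs.span (w ` I)" "\<forall>A\<in>I. f (\<omega> A) = 0"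
    then obtain c where "f = (\<Sum>x\<in>w ` I. fun_scale (c x) x)"
      using fs.span_finite[of "w ` I"] assms(1) by auto
    then have "f = (\<Sum>A\<in>I. fun_scale (c (w A)) (w A))"
      by (simp add: sum.reindex[OF inj])
    moreover from this have "c (w A) = 0" if "A \<in> I" for A
      using ev[OF that, of "\<lambda>A. c (w A)"] f(2) that by simp
    ultimately show "f = 0" by simp
  qed
qed

context vector_space
begin

text \<open>The wedges of the sets in \<open>I\<close> and the determinant forms built from the same
  sets are dual to each other. As these forms annihilate \<open>U\<close>, the wedges are
  independent modulo \<open>U\<close>, and each adds one dimension. The hypothesis
  \<open>kill\<close> covers every ordering, so that callers do not depend on the choice made by
  \<open>enum_set\<close>.\<close>

lemma dim_add_ext_power_ge:
  assumes D: "finite D" "D \<subseteq> H"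
    and \<phi>: "\<And>a. Vector_Spaces.linear scale (*) (\<phi> a)"
      "\<And>a b. a \<in> D \<Longrightarrow> b \<in> D \<Longrightarrow> \<phi> a b = (if a = b then 1 else 0)"
    and I: "I \<subseteq> {A. A \<subseteq> D \<and> card A = k}"
    and U: "fs.subspace U" "U \<subseteq> fs.span W" "finite W"
    and H: "H \<subseteq> span E" "finite E"
    and kill: "\<And>A f \<psi>s. A \<in> I \<Longrightarrow> f \<in> U \<Longrightarrow> length \<psi>s = k \<Longrightarrow> set \<psi>s = \<phi> ` A \<Longrightarrow> f (det_form k \<psi>s) = 0"
  shows "fs.dim U + card I \<le> fs.dim (U + ext_power scale k H)"
proof -
  have en: "distinct (enum_set A)" "set (enum_set A) = A" "length (enum_set A) = k" if "A \<in> I" for A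
  proof -
    have A: "finite A" "card A = k" using that I finite_subset[OF _ D(1)] by auto
    show "distinct (enum_set A)" "set (enum_set A) = A" using distinct_enum_set[OF A(1)] by auto
    then show "length (enum_set A) = k" using A(2) distinct_card by fastforce
  qed
  define \<omega> where "\<omega> A = det_form k (map \<phi> (enum_set A))" for A
  define w where "w A = wedge scale k (enum_set A)" for A
  have "I \<subseteq> {A. A \<subseteq> D}" using I by auto
  then have finI: "finite I" by (rule finite_subset) (simp add: D(1))
  have dual: "w A (\<omega> B) = (if A = B then 1 else 0)" if "A \<in> I" "B \<in> I" for A B
  proof -
    have eq: "w A (\<omega> B) = det_form k (map \<phi> (enum_set B)) (enum_set A)"
      unfolding w_def \<omega>_def by (rule wedge_eval_det_form) (use en that \<phi>(1) in auto)
    show ?thesis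
    proof (cases "A = B")
      case True
      have "det_form k (map \<phi> (enum_set B)) (enum_set B) = 1"
      proof (rule det_form_dual)
        fix i j assume ij: "i < k" "j < k"
        moreover have "B \<subseteq> D" using I that(2) by auto
        ultimately have "enum_set B ! i \<in> D" "enum_set B ! j \<in> D"
          using en(2,3)[OF that(2)] nth_mem[of i "enum_set B"] nth_mem[of j "enum_set B"] by auto
        then show "(map \<phi> (enum_set B) ! j) (enum_set B ! i) = (if i = j then 1 else 0)"
          using ij en[OF that(2)] \<phi>(2) by (auto simp: nth_eq_iff_index_eq)
      qed (use en that in simp)
      with True eq show ?thesis by simp
    next
      case False
      \<comment> \<open>For different \<open>k\<close>-sets some \<open>b \<in> B\<close> lies
        outside \<open>A\<close>, and \<open>\<phi> b\<close> vanishes on all of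
        \<open>A\<close>.\<close>
      have "finite A" "card A = card B" using that I finite_subset[OF _ D(1)] by auto
      with False have "\<not> B \<subseteq> A" using card_subset_eq[of A B] by auto
      then obtain b where b: "b \<in> B" "b \<notin> A" by blast
      have sub: "A \<subseteq> D" "B \<subseteq> D" using that I by auto
      have "det_form k (map \<phi> (enum_set B)) (enum_set A) = 0"
      proof (rule det_form_eq_0)
        show "\<phi> b \<in> set (map \<phi> (enum_set B))" using b en that by auto
        show "\<phi> b v = 0" if "v \<in> set (enum_set A)" for v
        proof -
          have "v \<in> A" using that en(2)[OF \<open>A \<in> I\<close>] by simp
          then have "v \<in> D" "b \<in> D" "b \<noteq> v" using b sub by auto
          then show ?thesis using \<phi>(2) by simp
        qed
      qed (use en that in simp_all)
      with False eq show ?thesis by simp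
    qed
  qed
  note indep = fs_independent_of_dual[of I w \<omega>, OF finI dual]
  obtain C where C: "finite C" "C \<subseteq> U" "fs.independent C" "U \<subseteq> fs.span C" "card C = fs.dim U"
    using fs.finite_basis_exists U(2,3) .
  have spC: "fs.span C = U" using C U(1) by (simp add: fs.span_subspace)
  have "f (\<omega> A) = 0" if "A \<in> I" "f \<in> U" for f A
    unfolding \<omega>_def using that en by (intro kill[of A f]) auto
  then have triv: "fs.span C \<inter> fs.span (w ` I) \<subseteq> {0}"
    using indep(3) unfolding spC by blast
  have ind: "fs.independent (C \<union> w ` I)"
    using finI by (intro fs.independent_Un_finite C(3) indep(2) triv) auto
  have dis: "C \<inter> w ` I = {}" by (rule fs.disjoint_of_trivial_Int[OF indep(2) triv])
  have card: "card (C \<union> w ` I) = fs.dim U + card I"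
    using C(1,5) finI dis card_image[OF indep(1)] by (simp add: card_Un_disjoint)
  have w: "w A \<in> ext_power scale k H" if "A \<in> I" for A
    unfolding w_def using en[OF that] that I D(2) by (intro wedge_in_ext_power) auto
  have "0 \<in> U" "0 \<in> ext_power scale k H"
    using U(1) subspace_ext_power by (auto intro: fs.subspace_0)
  then have "U \<subseteq> U + ext_power scale k H" "ext_power scale k H \<subseteq> U + ext_power scale k H"
    using set_zero_plus2[of "ext_power scale k H" U] set_zero_plus2[of U "ext_power scale k H"]
    by (simp_all add: add.commute)
  then have sub: "C \<union> w ` I \<subseteq> U + ext_power scale k H"
    using C(2) w by auto
  obtain W' where W': "finite W'" "ext_power scale k H \<subseteq> fs.span W'"
    by (rule ext_power_finite_span[OF H])
  have "U + ext_power scale k H \<subseteq> fs.span (W \<union> W')"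
    unfolding fs.span_Un using U(2) W'(2) by (auto simp: set_plus_def)
  then show ?thesis
    using fs.card_le_dim[OF ind sub] W'(1) U(3) card by simp
qed

end

subsection \<open>Binomial inequalities\<close>

text \<open>Convexity in the upper index: by Pascal's rule each unit step adds a coefficient with
  lower index \<open>k - 1\<close>, and this is larger when starting from \<open>q\<close>.\<close>

lemma binomial_exchange:
  assumes "p \<le> q"
  shows "(p + n choose k) + (q choose k) \<le> (p choose k) + (q + n choose k)"
proof (cases k)
  case (Suc j)
  show ?thesis
  proof (induction n)
    case (Suc n)
    have "(p + n choose j) \<le> (q + n choose j)" using assms by (intro binomial_right_mono) simp
    with Suc show ?case by (simp add: \<open>k = Suc j\<close>)
  qed simp
qed simp

text \<open>By convexity the sum is largest when as many terms as possible equal the maximum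
  \<open>r\<close>. The induction removes one term and updates quotient and remainder of the
  rest.\<close>

lemma sum_binomial_le:
  assumes "finite I" "1 \<le> k" "\<And>i. i \<in> I \<Longrightarrow> d i \<le> r" "(\<Sum>i\<in>I. d i) = a * r + b" "b < r"
  shows "(\<Sum>i\<in>I. d i choose k) \<le> a * (r choose k) + (b choose k)"
  using assms(1,3,4,5)
proof (induction I arbitrary: a b rule: finite_induct)
  case (insert j I)
  show ?case
  proof (cases "d j \<le> b")
    \<comment> \<open>The remainder absorbs \<open>d j\<close>. The exchange starts at 0, where
      \<open>0 choose k\<close> is 0 because \<open>1 \<le> k\<close>.\<close>
    case True
    then have "(\<Sum>i\<in>I. d i choose k) \<le> a * (r choose k) + (b - d j choose k)"
      using insert by (intro insert.IH) auto
    moreover have "(b - d j choose k) + (d j choose k) \<le> (b choose k)"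
      using binomial_exchange[of 0 "d j" "b - d j" k] True assms(2) by (simp add: binomial_eq_0)
    ultimately show ?thesis using insert.hyps by simp
  next
    \<comment> \<open>One \<open>r\<close> is borrowed from the quotient; the new remainder
      \<open>r + b - d j\<close> is below \<open>r\<close> since \<open>b < d j\<close>.\<close>
    case False
    have "d j \<le> r" using insert.prems by simp
    obtain a' where a: "a = Suc a'"
      using False insert.prems(2) insert.hyps by (cases a) auto
    have "d j + sum d I = r + a' * r + b" using insert.prems(2) insert.hyps by (simp add: a)
    then have "sum d I = a' * r + (r + b - d j)" "r + b - d j < r"
      using False \<open>d j \<le> r\<close> by linarith+
    then have "(\<Sum>i\<in>I. d i choose k) \<le> a' * (r choose k) + (r + b - d j choose k)"
      using insert.prems(1) by (intro insert.IH) auto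
    moreover have "(r + b - d j choose k) + (d j choose k) \<le> (b choose k) + (r choose k)"
      using binomial_exchange[of b "d j" "r - d j" k] False \<open>d j \<le> r\<close> by (simp add: add.commute)
    ultimately show ?thesis using insert.hyps by (simp add: a)
  qed
qed simp

lemma binomial_pascal:
  assumes "2 \<le> k" "1 \<le> n"
  shows "(n choose k) = (n - 1 choose (k - 1)) + (n - 1 choose k)"
  using assms by (cases n; cases k) auto

text \<open>Convexity moves the parts to 1 and \<open>p + q - 1\<close>; \<open>1 choose k\<close>
  is 0 as \<open>2 \<le> k\<close>, and Pascal's rule supplies the third term.\<close>

lemma binomial_split_le:
  assumes "2 \<le> k" "1 \<le> p" "1 \<le> q"
  shows "(p choose k) + (q choose k) + (p + q - 1 choose (k - 1)) \<le> (p + q choose k)"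
proof -
  have "(p choose k) + (q choose k) \<le> (p + q - 1 choose k)"
    using binomial_exchange[of 1 q "p - 1" k] assms by (simp add: binomial_eq_0 add.commute)
  then show ?thesis using binomial_pascal[of k "p + q"] assms by simp
qed

text \<open>The terms other than \<open>d j\<close> leave the remainder \<open>r - d j\<close>, and
  splitting \<open>r\<close> into \<open>r - d j\<close> and \<open>d j\<close> loses at least
  \<open>r - 1 choose (k - 1)\<close>.\<close>

lemma sum_binomial_le_strict:
  assumes "finite I" "2 \<le> k" "\<And>i. i \<in> I \<Longrightarrow> d i \<le> r" "(\<Sum>i\<in>I. d i) = a * r"
    and j: "j \<in> I" "0 < d j" "d j < r"
  shows "(\<Sum>i\<in>I. d i choose k) + (r - 1 choose (k - 1)) \<le> a * (r choose k)"
proof -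
  have sum: "d j + (\<Sum>i\<in>I - {j}. d i) = a * r"
    using assms(1,4) j(1) by (simp add: sum.remove)
  then obtain a' where a: "a = Suc a'" using j by (cases a) auto
  have "(\<Sum>i\<in>I - {j}. d i choose k) \<le> a' * (r choose k) + (r - d j choose k)"
    using assms sum by (intro sum_binomial_le) (auto simp: a)
  moreover have "(r - d j choose k) + (d j choose k) + (r - 1 choose (k - 1)) \<le> (r choose k)"
    using binomial_split_le[of k "r - d j" "d j"] assms(2) j by simp
  ultimately show ?thesis using assms(1) j(1) by (simp add: sum.remove a)
qed

text \<open>Source of the gap when \<open>b\<close> is positive: in units of \<beta>,
  \<open>b choose k\<close> is worth at most \<open>b - 1\<close>. By absorption
  \<open>k * (b choose k)\<close> equals \<open>(b - (k - 1)) * (b choose (k - 1))\<close>, which is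
  then bounded factor by factor.\<close>

lemma binomial_secant_le:
  assumes "2 \<le> k" "b < r"
  shows "(b choose k) * r \<le> (b - 1) * (r choose k)"
proof -
  have "b * (b - 1 choose (k - 1)) = (b - (k - 1)) * (b choose (k - 1))"
    by (simp add: binomial_absorb_comp)
  also have "\<dots> \<le> (b - 1) * (r - 1 choose (k - 1))"
    using assms by (intro mult_mono binomial_right_mono) auto
  finally have "k * (b choose k) \<le> (b - 1) * (r - 1 choose (k - 1))"
    using assms times_binomial_minus1_eq[of k b] by simp
  then have "k * (b choose k) * r \<le> (b - 1) * (r - 1 choose (k - 1)) * r"
    by (rule mult_right_mono) simp
  also have "\<dots> = (b - 1) * (k * (r choose k))"
    using assms times_binomial_minus1_eq[of k r] by simp
  finally have "k * ((b choose k) * r) \<le> k * ((b - 1) * (r choose k))"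
    by (simp add: ac_simps)
  then show ?thesis using assms by simp
qed

text \<open>By absorption \<open>r - 1 choose (k - 1)\<close> is exactly \<open>k\<close> units of
  \<beta>, so the extra term in the case \<open>b = 0\<close> is worth at least one.\<close>

lemma binomial_le_mult_pred:
  assumes "1 \<le> k"
  shows "(r choose k) \<le> r * (r - 1 choose (k - 1))"
proof -
  have "(r choose k) \<le> k * (r choose k)" using assms by simp
  also have "\<dots> = r * (r - 1 choose (k - 1))" using assms times_binomial_minus1_eq[of k r] by simp
  finally show ?thesis .
qed

lemma card_subsets_meeting:
  assumes "finite D" "finite B" "D \<inter> B = {}"
  shows "(card (D \<union> B) choose k) \<le>
    card {A. A \<subseteq> D \<union> B \<and> card A = k \<and> A \<inter> B \<noteq> {}} + (card D choose k)"
proof -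
  let ?I = "{A. A \<subseteq> D \<union> B \<and> card A = k \<and> A \<inter> B \<noteq> {}}"
  have fin: "finite ?I" by (rule finite_subset[of _ "Pow (D \<union> B)"]) (use assms in auto)
  have "(card (D \<union> B) choose k) = card {A. A \<subseteq> D \<union> B \<and> card A = k}"
    using assms by (simp add: n_subsets)
  also have "\<dots> \<le> card (?I \<union> {A. A \<subseteq> D \<and> card A = k})"
    using fin assms(1) by (intro card_mono) auto
  also have "\<dots> \<le> card ?I + card {A. A \<subseteq> D \<and> card A = k}"
    by (rule card_Un_le)
  finally show ?thesis using assms(1) by (simp add: n_subsets)
qed

text \<open>Only the \<open>k\<close>-subsets inside \<open>D\<close> or inside \<open>B\<close> are
  lost, and \<open>binomial_split_le\<close> compares them with all
  \<open>k\<close>-subsets.\<close>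

lemma card_subsets_meeting_both:
  assumes "finite D" "finite B" "D \<inter> B = {}" "D \<noteq> {}" "B \<noteq> {}" "2 \<le> k"
  shows "(card (D \<union> B) - 1 choose (k - 1)) \<le>
    card {A. A \<subseteq> D \<union> B \<and> card A = k \<and> A \<inter> D \<noteq> {} \<and> A \<inter> B \<noteq> {}}"
proof -
  let ?I = "{A. A \<subseteq> D \<union> B \<and> card A = k \<and> A \<inter> D \<noteq> {} \<and> A \<inter> B \<noteq> {}}"
  have fin: "finite ?I" by (rule finite_subset[of _ "Pow (D \<union> B)"]) (use assms in auto)
  have "(card (D \<union> B) choose k) = card {A. A \<subseteq> D \<union> B \<and> card A = k}"
    using assms by (simp add: n_subsets)
  also have "\<dots> \<le> card (?I \<union> ({A. A \<subseteq> D \<and> card A = k} \<union> {A. A \<subseteq> B \<and> card A = k}))"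
    using fin assms(1,2) by (intro card_mono) auto
  also have "\<dots> \<le> card ?I + card ({A. A \<subseteq> D \<and> card A = k} \<union> {A. A \<subseteq> B \<and> card A = k})"
    by (rule card_Un_le)
  also have "\<dots> \<le> card ?I + (card {A. A \<subseteq> D \<and> card A = k} + card {A. A \<subseteq> B \<and> card A = k})"
    by (intro add_left_mono card_Un_le)
  finally have "(card (D \<union> B) choose k) \<le> card ?I + ((card D choose k) + (card B choose k))"
    using assms(1,2) by (simp add: n_subsets)
  moreover have "card (D \<union> B) = card D + card B" "1 \<le> card D" "1 \<le> card B"
    using assms by (auto simp: card_Un_disjoint Suc_le_eq card_gt_0_iff)
  ultimately show ?thesis using binomial_split_le[of k "card D" "card B"] assms(6) by simp
qed

subsection \<open>Sums of subspaces\<close>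

context vector_space
begin

lemma dim_Int_le:
  assumes "subspace S" "subspace H" "H \<subseteq> span W" "finite W"
  shows "dim (S \<inter> H) \<le> dim H" "dim (S \<inter> H) = dim H \<Longrightarrow> H \<subseteq> S" "dim (S \<inter> H) = 0 \<Longrightarrow> S \<inter> H = {0}"
proof -
  obtain D B where DB: "finite D" "finite B" "D \<inter> B = {}" "independent (D \<union> B)"
    "span D = S \<inter> H" "span (D \<union> B) = H" "span B \<inter> S \<subseteq> {0}"
    by (rule relative_basis[OF assms])
  have "independent D" by (rule independent_mono[OF DB(4)]) simp
  then have dS: "dim (S \<inter> H) = card D" using dim_span_eq_card_independent DB(5) by metis
  have dH: "dim H = card D + card B"
    using dim_span_eq_card_independent[OF DB(4)] DB by (simp add: card_Un_disjoint)
  show "dim (S \<inter> H) \<le> dim H" using dS dH by simp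
  show "H \<subseteq> S" if "dim (S \<inter> H) = dim H"
    using that dS dH DB by auto
  show "S \<inter> H = {0}" if "dim (S \<inter> H) = 0"
    using that dS DB(1,5) by auto
qed

text \<open>Grassmann's formula: a basis of \<open>S\<close> and the block \<open>B\<close> from
  \<open>relative_basis\<close> together form a basis of \<open>S + H\<close>.\<close>

lemma dim_plus_Int:
  assumes "subspace S" "S \<subseteq> span V" "finite V" "subspace H" "H \<subseteq> span W" "finite W"
  shows "dim (S + H) + dim (S \<inter> H) = dim S + dim H"
proof -
  obtain D B where DB: "finite D" "finite B" "D \<inter> B = {}" "independent (D \<union> B)"
    "span D = S \<inter> H" "span (D \<union> B) = H" "span B \<inter> S \<subseteq> {0}"
    by (rule relative_basis[OF assms(1,4,5,6)])
  obtain C where C: "finite C" "C \<subseteq> S" "independent C" "S \<subseteq> span C" "card C = dim S"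
    by (rule finite_basis_exists[OF assms(2,3)])
  have spC: "span C = S" using C assms(1) by (simp add: span_subspace)
  have iD: "independent D" "independent B" by (rule independent_mono[OF DB(4)]; simp)+
  then have dS: "dim (S \<inter> H) = card D" using dim_span_eq_card_independent DB(5) by metis
  have dH: "dim H = card D + card B"
    using dim_span_eq_card_independent[OF DB(4)] DB by (simp add: card_Un_disjoint)
  have triv: "span C \<inter> span B \<subseteq> {0}" using DB(7) spC by auto
  have ind: "independent (C \<union> B)"
    by (rule independent_Un_finite[OF DB(2) C(3) iD(2) triv])
  have dis: "C \<inter> B = {}" by (rule disjoint_of_trivial_Int[OF iD(2) triv])
  have "span (C \<union> B) = S + H"
  proof
    have "span B \<subseteq> H" using span_mono[of B "D \<union> B"] DB(6) by auto
    then show "span (C \<union> B) \<subseteq> S + H"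
      unfolding span_Un spC by (auto simp: set_plus_def)
    have "S \<subseteq> span (C \<union> B)" using spC span_mono[of C "C \<union> B"] by auto
    moreover have "span D \<subseteq> span (C \<union> B)" using calculation DB(5) by auto
    then have "D \<union> B \<subseteq> span (C \<union> B)" using span_superset[of D] span_superset[of "C \<union> B"] by blast
    then have "H \<subseteq> span (C \<union> B)" using DB(6) span_minimal by blast
    ultimately show "S + H \<subseteq> span (C \<union> B)"
      by (auto elim!: set_plus_elim intro!: span_add)
  qed
  then have "dim (S + H) = card (C \<union> B)"
    using dim_span_eq_card_independent[OF ind] by simp
  then show ?thesis using dS dH C(1,5) DB(2) dis by (simp add: card_Un_disjoint)
qed

lemma subspace_sum_sets:
  assumes "finite I" "\<And>i. i \<in> I \<Longrightarrow> subspace (H i)"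
  shows "subspace (\<Sum>i\<in>I. H i)"
  using assms by (induction I rule: finite_induct) (auto intro: subspace_set_plus)

lemma finite_span_sum_sets:
  assumes "finite I" "\<And>i. i \<in> I \<Longrightarrow> \<exists>W. finite W \<and> H i \<subseteq> span W"
  shows "\<exists>W. finite W \<and> (\<Sum>i\<in>I. H i) \<subseteq> span W"
  using assms
proof (induction I rule: finite_induct)
  case empty
  then show ?case by (intro exI[of _ "{}"]) simp
next
  case (insert i I)
  then obtain V where "finite V" "(\<Sum>i\<in>I. H i) \<subseteq> span V" by auto
  moreover obtain W where "finite W" "H i \<subseteq> span W" using insert.prems by blast
  ultimately have "finite (W \<union> V)" "H i + (\<Sum>i\<in>I. H i) \<subseteq> span (W \<union> V)"
    unfolding span_Un by (auto elim!: set_plus_elim)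
  then show ?case using insert.hyps by auto
qed

lemma dim_sum_sets_le:
  fixes n :: nat
  assumes "\<And>i. i < n \<Longrightarrow> subspace (H i)" "\<And>i. i < n \<Longrightarrow> \<exists>W. finite W \<and> H i \<subseteq> span W"
  shows "dim (\<Sum>i<n. H i) \<le> (\<Sum>i<n. dim (H i))"
  using assms
proof (induction n)
  case 0
  have "dim {0} = 0" using dim_eq_card_independent[OF independent_empty] dim_span[of "{}"] by simp
  then show ?case by simp
next
  case (Suc n)
  obtain V where V: "finite V" "(\<Sum>i<n. H i) \<subseteq> span V"
    using finite_span_sum_sets[of "{..<n}" H] Suc.prems(2) by auto
  obtain W where W: "finite W" "H n \<subseteq> span W" using Suc.prems(2) by blast
  have "dim ((\<Sum>i<n. H i) + H n) + dim ((\<Sum>i<n. H i) \<inter> H n) = dim (\<Sum>i<n. H i) + dim (H n)"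
    using Suc.prems(1) by (intro dim_plus_Int[OF _ V(2,1) _ W(2,1)] subspace_sum_sets) auto
  moreover have "dim (\<Sum>i<n. H i) \<le> (\<Sum>i<n. dim (H i))" using Suc by auto
  ultimately show ?case by simp
qed

text \<open>A common vector has one decomposition supported on \<open>I\<close> and another
  supported at \<open>l\<close>; uniqueness makes it 0.\<close>

lemma direct_sum_imp_Int:
  assumes "direct_sum t H" "\<And>i. i < t \<Longrightarrow> subspace (H i)" "I \<subseteq> {..<t}" "l < t" "l \<notin> I"
  shows "(\<Sum>i\<in>I. H i) \<inter> H l \<subseteq> {0}"
proof
  fix x assume x: "x \<in> (\<Sum>i\<in>I. H i) \<inter> H l"
  have fin: "finite I" using assms(3) finite_subset by blast
  then obtain s where s: "x = sum s I" "\<forall>i\<in>I. s i \<in> H i" using x by (auto simp: set_sum_alt)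
  define u where "u i = (if i \<in> I then s i else 0)" for i
  define v where "v i = (if i = l then x else 0)" for i
  have "sum u {..<t} = sum v {..<t}"
    using assms(3,4) s(1) by (simp add: u_def v_def sum.If_cases Int_absorb1)
  moreover have "\<forall>i<t. u i \<in> H i" "\<forall>i<t. v i \<in> H i"
    using s(2) x assms(2) by (auto simp: u_def v_def intro: subspace_0)
  ultimately have "u l = v l" using assms(1,4) unfolding direct_sum_def by blast
  then show "x \<in> {0}" using assms(5) by (simp add: u_def v_def)
qed

text \<open>In a vanishing sum the last summand is minus the sum of the earlier ones, hence 0;
  descending removes all summands.\<close>

lemma direct_sum_if_Int:
  assumes "\<And>i. i < t \<Longrightarrow> subspace (H i)" "\<And>i. i < t \<Longrightarrow> (\<Sum>l<i. H l) \<inter> H i \<subseteq> {0}"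
  shows "direct_sum t H"
proof -
  have "\<forall>i<n. z i = 0" if "n \<le> t" "\<forall>i<n. z i \<in> H i" "sum z {..<n} = 0" for n z
    using that
  proof (induction n)
    case (Suc n)
    have sub: "subspace (\<Sum>l<n. H l)"
      using assms(1) Suc.prems by (intro subspace_sum_sets) auto
    have "sum z {..<n} \<in> (\<Sum>l<n. H l)"
      unfolding set_sum_alt[OF finite_lessThan] using Suc.prems(2) by auto
    moreover have "z n = - sum z {..<n}" using Suc.prems(3) by (simp add: eq_neg_iff_add_eq_0 add.commute)
    ultimately have "z n \<in> (\<Sum>l<n. H l) \<inter> H n"
      using Suc.prems(2) subspace_neg[OF sub] by (metis IntI lessI)
    with assms(2)[of n] Suc.prems(1) have "z n = 0" by auto
    with Suc show ?case by (auto simp: less_Suc_eq)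
  qed simp
  then have zero: "\<forall>i<t. z i = 0" if "\<forall>i<t. z i \<in> H i" "sum z {..<t} = 0" for z
    using that by blast
  show ?thesis
    unfolding direct_sum_def
  proof (intro allI impI; elim conjE)
    fix x y :: "nat \<Rightarrow> 'b" and i
    assume "\<forall>i<t. x i \<in> H i" "\<forall>i<t. y i \<in> H i" "sum x {..<t} = sum y {..<t}" "i < t"
    then show "x i = y i"
      using zero[of "\<lambda>i. x i - y i"] assms(1) by (simp add: sum_subtractf subspace_diff)
  qed
qed

text \<open>A first block \<open>D\<close> gets functionals vanishing on \<open>Q\<close>. Their
  common kernel in \<open>K\<close> supplies the second block \<open>B\<close>, with functionals
  vanishing on \<open>P\<close>.\<close>

lemma two_block_functionals:
  assumes K: "subspace K" "K \<subseteq> span W" "finite W" "2 \<le> dim K"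
    and PQ: "subspace P" "subspace Q" "P \<inter> Q \<subseteq> {0}"
    and notin: "\<not> K \<subseteq> P" "\<not> K \<subseteq> Q"
  obtains D B \<phi> where "finite D" "finite B" "D \<inter> B = {}" "D \<noteq> {}" "B \<noteq> {}" "D \<union> B \<subseteq> K"
    "card (D \<union> B) = dim K" "\<And>a. Vector_Spaces.linear scale (*) (\<phi> a)"
    "\<And>a b. a \<in> D \<union> B \<Longrightarrow> b \<in> D \<union> B \<Longrightarrow> \<phi> a b = (if a = b then 1 else 0)"
    "\<And>a x. a \<in> D \<Longrightarrow> x \<in> Q \<Longrightarrow> \<phi> a x = 0" "\<And>a x. a \<in> B \<Longrightarrow> x \<in> P \<Longrightarrow> \<phi> a x = 0"
proof -
  note witness = that
  \<comment> \<open>The passage from \<open>D\<close> to \<open>B\<close>, shared by both cases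
    below. Since \<open>S\<close> contains \<open>P\<close> and \<open>D\<close>, functionals
    vanishing on \<open>S\<close> kill \<open>P\<close> and the first block; by \<open>triv\<close>
    the common kernel \<open>L\<close> meets \<open>S\<close> only in 0.\<close>
  have extend: thesis
    if D: "finite D" "D \<noteq> {}" "D \<subseteq> K \<inter> S" "independent D" "\<not> K \<subseteq> span D"
      and S: "subspace S" "P \<subseteq> S"
      and \<phi>: "\<And>a. Vector_Spaces.linear scale (*) (\<phi> a)"
        "\<And>a b. a \<in> D \<Longrightarrow> b \<in> D \<Longrightarrow> \<phi> a b = (if a = b then 1 else 0)"
        "\<And>a x. a \<in> D \<Longrightarrow> x \<in> Q \<Longrightarrow> \<phi> a x = 0"
      and triv: "\<And>x. x \<in> K \<Longrightarrow> x \<in> S \<Longrightarrow> (\<And>a. a \<in> D \<Longrightarrow> \<phi> a x = 0) \<Longrightarrow> x = 0"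
    for D S \<phi>
  proof -
    have hom: "module_hom scale (*) (\<phi> a)" for a
      using \<phi>(1) by (simp add: module_hom_iff_linear)
    define L where "L = {x \<in> K. \<forall>a\<in>D. \<phi> a x = 0}"
    have "L = K \<inter> (\<Inter>a\<in>D. {x. \<phi> a x = 0})" using D(2) by (auto simp: L_def)
    then have L: "subspace L"
      using K(1) module_hom.subspace_kernel[OF hom] by (auto intro!: subspace_inter subspace_Int)
    obtain B where B: "finite B" "B \<subseteq> L" "independent B" "L \<subseteq> span B"
      by (rule finite_basis_exists[of L W]) (use K in \<open>auto simp: L_def\<close>)
    have spB: "span B = L" using B L by (simp add: span_subspace)
    have trivS: "span B \<inter> S \<subseteq> {0}" unfolding spB using triv by (auto simp: L_def)
    have "span D \<subseteq> S" using D(3) S(1) by (intro span_minimal) auto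
    then have trivD: "span D \<inter> span B \<subseteq> {0}" using trivS by blast
    obtain \<psi> where \<psi>: "\<And>a. Vector_Spaces.linear scale (*) (\<psi> a)"
      "\<And>a b. a \<in> B \<Longrightarrow> b \<in> B \<Longrightarrow> \<psi> a b = (if a = b then 1 else 0)"
      "\<And>a s. a \<in> B \<Longrightarrow> s \<in> S \<Longrightarrow> \<psi> a s = 0"
      by (rule dual_functionals[OF B(1,3) S(1) trivS]) blast
    \<comment> \<open>Subtracting from \<open>x\<close> the combination of \<open>D\<close> with
      coefficients \<open>\<phi> a x\<close> leaves a vector of \<open>L\<close>.\<close>
    have "K \<subseteq> span (D \<union> B)"
    proof
      fix x assume x: "x \<in> K"
      define y where "y = (\<Sum>a\<in>D. scale (\<phi> a x) a)"
      have "y \<in> span D" unfolding y_def by (intro span_sum span_scale span_base)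
      have "y \<in> K" unfolding y_def using D(3) K(1) by (intro subspace_sum subspace_scale) auto
      have "\<phi> b y = \<phi> b x" if "b \<in> D" for b
      proof -
        interpret \<phi>b: module_hom scale "(*)" "\<phi> b" by (rule hom)
        have "\<phi> b y = (\<Sum>a\<in>D. \<phi> a x * \<phi> b a)" by (simp add: y_def \<phi>b.sum \<phi>b.scale)
        also have "\<dots> = (\<Sum>a\<in>D. if a = b then \<phi> a x else 0)"
          using that \<phi>(2) by (intro sum.cong) auto
        finally show ?thesis using D(1) that by simp
      qed
      then have "x - y \<in> L"
        using x \<open>y \<in> K\<close> K(1) module_hom.diff[OF hom] by (auto simp: L_def subspace_diff)
      then have "x - y \<in> span (D \<union> B)" using B(4) span_mono[of B "D \<union> B"] by auto
      moreover have "y \<in> span (D \<union> B)" using \<open>y \<in> span D\<close> span_mono[of D "D \<union> B"] by auto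
      ultimately have "(x - y) + y \<in> span (D \<union> B)" by (rule span_add)
      then show "x \<in> span (D \<union> B)" by simp
    qed
    moreover have DBK: "D \<union> B \<subseteq> K" using D(3) B(2) by (auto simp: L_def)
    moreover have "independent (D \<union> B)"
      by (rule independent_Un_finite[OF B(1) D(4) B(3) trivD])
    ultimately have card: "card (D \<union> B) = dim K" by (intro basis_card_eq_dim)
    have dis: "D \<inter> B = {}" by (rule disjoint_of_trivial_Int[OF B(3) trivD])
    have "B \<noteq> {}" using \<open>K \<subseteq> span (D \<union> B)\<close> D(5) by auto
    \<comment> \<open>Duality holds across the blocks too: the \<open>\<phi> a\<close> vanish on
      \<open>B\<close>, which lies in their kernel, and the \<open>\<psi> a\<close> vanish on
      \<open>D\<close>, which lies in \<open>S\<close>.\<close>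
    define \<chi> where "\<chi> a = (if a \<in> D then \<phi> a else \<psi> a)" for a
    show thesis
    proof (rule witness[of D B \<chi>])
      show "Vector_Spaces.linear scale (*) (\<chi> a)" for a
        using \<phi>(1) \<psi>(1) by (simp add: \<chi>_def)
      show "\<chi> a b = (if a = b then 1 else 0)" if "a \<in> D \<union> B" "b \<in> D \<union> B" for a b
        using that dis \<phi>(2) \<psi>(2,3) B(2) D(3) by (auto simp: \<chi>_def L_def)
      show "\<chi> a x = 0" if "a \<in> D" "x \<in> Q" for a x using that \<phi>(3) by (simp add: \<chi>_def)
      show "\<chi> a x = 0" if "a \<in> B" "x \<in> P" for a x
        using that \<psi>(3) dis S(2) by (auto simp: \<chi>_def)
    qed (use D(1,2) B(1) dis \<open>B \<noteq> {}\<close> DBK card in auto)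
  qed
  show thesis
  proof (cases "K \<inter> P = {0}")
    \<comment> \<open>Here \<open>D\<close> is a basis of \<open>K \<inter> P\<close> and
      \<open>S = P\<close>. Dual functionals vanishing on \<open>Q\<close> exist because
      \<open>P \<inter> Q\<close> is trivial, and \<open>K\<close> exceeds \<open>span D\<close>
      because it is not contained in \<open>P\<close>.\<close>
    case False
    obtain D where D: "finite D" "D \<subseteq> K \<inter> P" "independent D" "K \<inter> P \<subseteq> span D"
      by (rule finite_basis_exists[of "K \<inter> P" W]) (use K(2,3) in auto)
    have "subspace (K \<inter> P)" using K(1) PQ(1) by (rule subspace_inter)
    then have spD: "span D = K \<inter> P" using D by (simp add: span_subspace)
    obtain \<phi> where \<phi>: "\<And>a. Vector_Spaces.linear scale (*) (\<phi> a)"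
      "\<And>a b. a \<in> D \<Longrightarrow> b \<in> D \<Longrightarrow> \<phi> a b = (if a = b then 1 else 0)"
      "\<And>a s. a \<in> D \<Longrightarrow> s \<in> Q \<Longrightarrow> \<phi> a s = 0"
      by (rule dual_functionals[OF D(1,3) PQ(2)]) (use spD PQ(3) in auto)
    show thesis
    proof (rule extend[of D P \<phi>])
      show "Vector_Spaces.linear scale (*) (\<phi> a)" for a by (rule \<phi>(1))
      show "\<phi> a b = (if a = b then 1 else 0)" if "a \<in> D" "b \<in> D" for a b by (rule \<phi>(2)[OF that])
      show "\<phi> a x = 0" if "a \<in> D" "x \<in> Q" for a x by (rule \<phi>(3)[OF that])
      show "D \<noteq> {}"
      proof
        assume "D = {}"
        then show False using False spD by simp
      qed
      show "\<not> K \<subseteq> span D" using notin(1) unfolding spD by simp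
      fix x assume x: "x \<in> K" "x \<in> P" "\<And>a. a \<in> D \<Longrightarrow> \<phi> a x = 0"
      then have "x \<in> span D" using spD by blast
      then obtain c where c: "x = (\<Sum>a\<in>D. scale (c a) a)" using span_finite[OF D(1)] by auto
      have "c b = 0" if "b \<in> D" for b
      proof -
        interpret \<phi>b: Vector_Spaces.linear scale "(*)" "\<phi> b" by (rule \<phi>(1))
        have "\<phi> b x = (\<Sum>a\<in>D. c a * \<phi> b a)" by (simp add: c \<phi>b.sum \<phi>b.scale)
        also have "\<dots> = (\<Sum>a\<in>D. if a = b then c a else 0)"
          using that \<phi>(2) by (intro sum.cong) auto
        finally show ?thesis using D(1) that x(3) by simp
      qed
      then show "x = 0" using c by simp
    qed (use D PQ(1) in auto)
  next
    \<comment> \<open>With \<open>K \<inter> P\<close> trivial, a single vector \<open>v\<close> of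
      \<open>K\<close> outside \<open>Q\<close> forms \<open>D\<close>, and \<open>S\<close> is
      \<open>P\<close> enlarged by \<open>v\<close>. Now \<open>2 \<le> dim K\<close> keeps
      \<open>B\<close> non-empty.\<close>
    case True
    obtain v where v: "v \<in> K" "v \<notin> Q" using notin(2) by blast
    then have "v \<noteq> 0" using PQ(2) subspace_0 by blast
    have trivQ: "span {v} \<inter> Q \<subseteq> {0}"
    proof clarsimp
      fix x assume "x \<in> span {v}" "x \<in> Q"
      then obtain c where c: "x = scale c v" by (auto simp: span_singleton)
      show "x = 0"
      proof (rule ccontr)
        assume "x \<noteq> 0"
        then have "v = scale (inverse c) x" using c by auto
        with v(2) \<open>x \<in> Q\<close> PQ(2) show False by (auto dest: subspace_scale)
      qed
    qed
    obtain \<phi> where \<phi>: "\<And>a. Vector_Spaces.linear scale (*) (\<phi> a)"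
      "\<And>a b. a \<in> {v} \<Longrightarrow> b \<in> {v} \<Longrightarrow> \<phi> a b = (if a = b then 1 else 0)"
      "\<And>a s. a \<in> {v} \<Longrightarrow> s \<in> Q \<Longrightarrow> \<phi> a s = 0"
      by (rule dual_functionals[of "{v}" Q]) (use \<open>v \<noteq> 0\<close> PQ(2) trivQ in auto)
    show thesis
    proof (rule extend[of "{v}" "span (insert v P)" \<phi>])
      show "Vector_Spaces.linear scale (*) (\<phi> a)" for a by (rule \<phi>(1))
      show "\<phi> a b = (if a = b then 1 else 0)" if "a \<in> {v}" "b \<in> {v}" for a b by (rule \<phi>(2)[OF that])
      show "\<phi> a x = 0" if "a \<in> {v}" "x \<in> Q" for a x by (rule \<phi>(3)[OF that])
      show "{v} \<subseteq> K \<inter> span (insert v P)" using v by (auto intro: span_base)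
      show "\<not> K \<subseteq> span {v}" using dim_le_card[of K "{v}"] K(4) by auto
      show "P \<subseteq> span (insert v P)" using span_superset by blast
      fix x assume x: "x \<in> K" "x \<in> span (insert v P)" "\<And>a. a \<in> {v} \<Longrightarrow> \<phi> a x = 0"
      \<comment> \<open>The difference lies in the trivial \<open>K \<inter> P\<close>, so
        \<open>x\<close> is a multiple of \<open>v\<close>, with coefficient
        \<open>\<phi> v x = 0\<close>.\<close>
      then obtain c where "x - scale c v \<in> span P" unfolding span_breakdown_eq by blast
      then have "x - scale c v \<in> K \<inter> P"
        using PQ(1) x(1) v(1) K(1) by (simp add: subspace_diff subspace_scale span_eq_iff[THEN iffD2])
      then have "x = scale c v" using True by simp
      interpret \<phi>v: Vector_Spaces.linear scale "(*)" "\<phi> v" by (rule \<phi>(1))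
      have "\<phi> v x = c" using \<open>x = scale c v\<close> \<phi>(2) by (simp add: \<phi>v.scale)
      then show "x = 0" using x(3) \<open>x = scale c v\<close> by simp
    qed (use \<open>v \<noteq> 0\<close> in auto)
  qed
qed

end

subsection \<open>Growth of the sum of exterior powers\<close>

context vector_space
begin

text \<open>Each summand may be killed by its own functional from \<open>\<phi>s\<close>; this later
  allows a direct sum to be annihilated in two pieces.\<close>

lemma sum_ext_power_eval_eq_0:
  fixes n :: nat
  assumes "f \<in> (\<Sum>i<n. ext_power scale k (H i))" "length \<phi>s = k"
    and "\<And>i. i < n \<Longrightarrow> \<exists>\<phi>\<in>set \<phi>s. \<forall>x\<in>H i. \<phi> x = 0"
  shows "f (det_form k \<phi>s) = 0"
  using assms(1,3)
proof (induction n arbitrary: f)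
  case (Suc n)
  then obtain g h where gh: "f = g + h" "g \<in> (\<Sum>i<n. ext_power scale k (H i))" "h \<in> ext_power scale k (H n)"
    by (auto elim: set_plus_elim)
  moreover obtain \<phi> where "\<phi> \<in> set \<phi>s" "\<forall>x\<in>H n. \<phi> x = 0" using Suc.prems(2) by blast
  then have "h (det_form k \<phi>s) = 0"
    using ext_power_eval_eq_0[OF gh(3) assms(2)] by blast
  ultimately show ?case using Suc by (simp add: plus_fun_def)
qed simp

text \<open>The \<open>k\<close>-subsets of \<open>D \<union> B\<close> meeting \<open>B\<close>
  give forms with a factor vanishing on \<open>S\<close>, and these kill \<open>U\<close>. Lost are
  only the \<open>k\<close>-subsets of the basis \<open>D\<close> of
  \<open>S \<inter> K\<close>.\<close>

lemma dim_add_ext_power_generic: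
  assumes S: "subspace S" and K: "subspace K" "K \<subseteq> span V" "finite V"
    and U: "fs.subspace U" "U \<subseteq> fs.span W" "finite W"
    and kill: "\<And>f \<psi>s \<psi>. f \<in> U \<Longrightarrow> length \<psi>s = k \<Longrightarrow> \<psi> \<in> set \<psi>s \<Longrightarrow> (\<And>x. x \<in> S \<Longrightarrow> \<psi> x = 0) \<Longrightarrow>
      f (det_form k \<psi>s) = 0"
  shows "fs.dim U + (dim K choose k) \<le> fs.dim (U + ext_power scale k K) + (dim (S \<inter> K) choose k)"
proof -
  obtain D B where DB: "finite D" "finite B" "D \<inter> B = {}" "independent (D \<union> B)"
    "span D = S \<inter> K" "span (D \<union> B) = K" "span B \<inter> S \<subseteq> {0}"
    by (rule relative_basis[OF S K])
  have iDB: "independent D" "independent B" by (rule independent_mono[OF DB(4)]; simp)+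
  obtain \<phi> where \<phi>: "\<And>a. Vector_Spaces.linear scale (*) (\<phi> a)"
    "\<And>a b. a \<in> D \<union> B \<Longrightarrow> b \<in> D \<union> B \<Longrightarrow> \<phi> a b = (if a = b then 1 else 0)"
    by (rule dual_functionals[of "D \<union> B" "{0}"]) (use DB(1,2,4) in auto)
  obtain \<psi> where \<psi>: "\<And>a. Vector_Spaces.linear scale (*) (\<psi> a)"
    "\<And>a b. a \<in> B \<Longrightarrow> b \<in> B \<Longrightarrow> \<psi> a b = (if a = b then 1 else 0)"
    "\<And>a s. a \<in> B \<Longrightarrow> s \<in> S \<Longrightarrow> \<psi> a s = 0"
    by (rule dual_functionals[OF DB(2) iDB(2) S DB(7)]) blast
  \<comment> \<open>The functionals for \<open>D\<close> are dual on the whole basis; those for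
    \<open>B\<close> vanish on \<open>S\<close>, hence also on \<open>D\<close>.\<close>
  define \<chi> where "\<chi> a = (if a \<in> B then \<psi> a else \<phi> a)" for a
  have DS: "D \<subseteq> S" using DB(5) span_superset[of D] by blast
  define I where "I = {A. A \<subseteq> D \<union> B \<and> card A = k \<and> A \<inter> B \<noteq> {}}"
  have "fs.dim U + card I \<le> fs.dim (U + ext_power scale k K)"
  proof (rule dim_add_ext_power_ge[where D = "D \<union> B" and \<phi> = \<chi> and E = V and W = W])
    show "D \<union> B \<subseteq> K" using DB(6) span_superset[of "D \<union> B"] by simp
    show "Vector_Spaces.linear scale (*) (\<chi> a)" for a using \<phi>(1) \<psi>(1) by (simp add: \<chi>_def)
    show "\<chi> a b = (if a = b then 1 else 0)" if "a \<in> D \<union> B" "b \<in> D \<union> B" for a b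
      using that \<phi>(2)[of a b] \<psi>(2,3)[of a b] DS DB(3) by (auto simp: \<chi>_def)
    show "I \<subseteq> {A. A \<subseteq> D \<union> B \<and> card A = k}" by (auto simp: I_def)
    fix A f \<psi>s assume A: "A \<in> I" "f \<in> U" "length \<psi>s = k" "set \<psi>s = \<chi> ` A"
    then obtain b where "b \<in> A" "b \<in> B" by (auto simp: I_def)
    then show "f (det_form k \<psi>s) = 0"
      using A \<psi>(3) by (intro kill[of f \<psi>s "\<chi> b"]) (auto simp: \<chi>_def)
  qed (use DB(1,2) U K in auto)
  moreover have "(card (D \<union> B) choose k) \<le> card I + (card D choose k)"
    unfolding I_def using DB(1-3) by (rule card_subsets_meeting)
  moreover have "card (D \<union> B) = dim K" "card D = dim (S \<inter> K)"
    using dim_span_eq_card_independent[OF DB(4)] dim_span_eq_card_independent[OF iDB(1)] DB(5,6) by simp_all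
  ultimately show ?thesis by simp
qed

text \<open>A \<open>k\<close>-subset meeting both blocks of \<open>two_block_functionals\<close>
  gives a form with one factor vanishing on \<open>P\<close> and one on \<open>Q\<close>.\<close>

lemma dim_add_ext_power_in_direct_sum:
  assumes K: "subspace K" "K \<subseteq> span V" "finite V" "2 \<le> dim K"
    and PQ: "subspace P" "subspace Q" "P \<inter> Q \<subseteq> {0}" "\<not> K \<subseteq> P" "\<not> K \<subseteq> Q" and k: "2 \<le> k"
    and U: "fs.subspace U" "U \<subseteq> fs.span W" "finite W"
    and kill: "\<And>f \<psi>s \<psi> \<psi>'. f \<in> U \<Longrightarrow> length \<psi>s = k \<Longrightarrow> \<psi> \<in> set \<psi>s \<Longrightarrow> \<psi>' \<in> set \<psi>s \<Longrightarrow>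
      (\<And>x. x \<in> P \<Longrightarrow> \<psi> x = 0) \<Longrightarrow> (\<And>x. x \<in> Q \<Longrightarrow> \<psi>' x = 0) \<Longrightarrow> f (det_form k \<psi>s) = 0"
  shows "fs.dim U + (dim K - 1 choose (k - 1)) \<le> fs.dim (U + ext_power scale k K)"
proof -
  obtain D B \<phi> where DB: "finite D" "finite B" "D \<inter> B = {}" "D \<noteq> {}" "B \<noteq> {}" "D \<union> B \<subseteq> K"
    "card (D \<union> B) = dim K"
    and \<phi>: "\<And>a. Vector_Spaces.linear scale (*) (\<phi> a)"
    "\<And>a b. a \<in> D \<union> B \<Longrightarrow> b \<in> D \<union> B \<Longrightarrow> \<phi> a b = (if a = b then 1 else 0)"
    "\<And>a x. a \<in> D \<Longrightarrow> x \<in> Q \<Longrightarrow> \<phi> a x = 0" "\<And>a x. a \<in> B \<Longrightarrow> x \<in> P \<Longrightarrow> \<phi> a x = 0"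
    by (rule two_block_functionals[OF K PQ]) blast
  define I where "I = {A. A \<subseteq> D \<union> B \<and> card A = k \<and> A \<inter> D \<noteq> {} \<and> A \<inter> B \<noteq> {}}"
  have "fs.dim U + card I \<le> fs.dim (U + ext_power scale k K)"
  proof (rule dim_add_ext_power_ge[where D = "D \<union> B" and \<phi> = \<phi> and E = V and W = W])
    show "I \<subseteq> {A. A \<subseteq> D \<union> B \<and> card A = k}" by (auto simp: I_def)
    fix A f \<psi>s assume A: "A \<in> I" "f \<in> U" "length \<psi>s = k" "set \<psi>s = \<phi> ` A"
    then obtain a b where "a \<in> A" "a \<in> D" "b \<in> A" "b \<in> B" by (auto simp: I_def)
    then show "f (det_form k \<psi>s) = 0"
      using A \<phi>(3,4) by (intro kill[of f \<psi>s "\<phi> b" "\<phi> a"]) auto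
  qed (use DB U K \<phi>(1,2) in auto)
  moreover have "(dim K - 1 choose (k - 1)) \<le> card I"
    using card_subsets_meeting_both[OF DB(1-5) k] DB(7) by (simp add: I_def)
  ultimately show ?thesis by simp
qed

end

section \<open>Families of distinct subspaces of equal dimension\<close>

locale equidim_family = vector_space scale for scale :: "'a::field \<Rightarrow> 'b::ab_group_add \<Rightarrow> 'b" +
  fixes k r t :: nat and H :: "nat \<Rightarrow> 'b set"
  assumes k: "2 \<le> k" "k \<le> r" and fam: "subspace_family scale r t H"
begin

lemma H_subspace: "i < t \<Longrightarrow> subspace (H i)" and H_dim: "i < t \<Longrightarrow> dim (H i) = r"
  and H_inj: "i < t \<Longrightarrow> j < t \<Longrightarrow> H i = H j \<Longrightarrow> i = j"
  using fam by (auto simp: subspace_family_def inj_on_def)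

lemma H_finite:
  assumes "i < t"
  shows "\<exists>W. finite W \<and> H i \<subseteq> span W"
proof -
  have "0 < dim (H i)" using H_dim[OF assms] k by simp
  then obtain W where "finite W" "H i \<subseteq> span W" by (rule finite_span_of_dim_pos)
  then show ?thesis by blast
qed

abbreviation "S n \<equiv> \<Sum>i<n. H i"
abbreviation "U n \<equiv> \<Sum>i<n. ext_power scale k (H i)"
abbreviation "d n \<equiv> dim (S n \<inter> H n)"

lemma S_subspace:
  assumes "I \<subseteq> {..<t}"
  shows "subspace (\<Sum>i\<in>I. H i)"
proof (rule subspace_sum_sets)
  show "finite I" using assms finite_lessThan by (rule finite_subset)
qed (use assms H_subspace in auto)

lemma S_finite: "n \<le> t \<Longrightarrow> \<exists>W. finite W \<and> S n \<subseteq> span W"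
  by (intro finite_span_sum_sets H_finite) auto

lemma U_subspace: "fs.subspace (U n)"
  by (intro fs.subspace_sum_sets subspace_ext_power) simp

lemma ext_power_H_finite:
  assumes "i < t"
  shows "\<exists>W. finite W \<and> ext_power scale k (H i) \<subseteq> fs.span W"
proof -
  obtain D where "H i \<subseteq> span D" "finite D" using H_finite[OF assms] by blast
  then obtain W where "finite W" "ext_power scale k (H i) \<subseteq> fs.span W"
    by (rule ext_power_finite_span)
  then show ?thesis by blast
qed

lemma U_finite: "n \<le> t \<Longrightarrow> \<exists>W. finite W \<and> U n \<subseteq> fs.span W"
  by (intro fs.finite_span_sum_sets ext_power_H_finite) auto

lemma
  assumes "n < t"
  shows d_le: "d n \<le> r"
    and H_subset_if: "d n = r \<Longrightarrow> H n \<subseteq> S n"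
    and Int_trivial_if: "d n = 0 \<Longrightarrow> S n \<inter> H n = {0}"
proof -
  obtain W where W: "H n \<subseteq> span W" "finite W" using H_finite[OF assms] by blast
  have "subspace (S n)" using assms by (intro S_subspace) auto
  note dim_Int = dim_Int_le[OF this H_subspace[OF assms] W]
  show "d n \<le> r" using dim_Int(1) H_dim[OF assms] by simp
  show "H n \<subseteq> S n" if "d n = r" using dim_Int(2) H_dim[OF assms] that by simp
  show "S n \<inter> H n = {0}" if "d n = 0" using dim_Int(3) that .
qed

text \<open>Grassmann's formula, telescoped; at \<open>n = t\<close> it identifies \<Phi> with the
  sum of the \<open>d i\<close>.\<close>

lemma sum_d: "(\<Sum>i<n. d i) + dim (S n) = n * r" if "n \<le> t"
  using that
proof (induction n)
  case 0
  have "dim {0} = 0" using dim_eq_card_independent[OF independent_empty] dim_span[of "{}"] by simp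
  then show ?case by simp
next
  case (Suc n)
  obtain V where "finite V" "S n \<subseteq> span V" using S_finite[of n] Suc.prems by auto
  moreover obtain W where "finite W" "H n \<subseteq> span W" using H_finite[of n] Suc.prems by auto
  ultimately have "dim (S n + H n) + d n = dim (S n) + dim (H n)"
    using Suc.prems by (intro dim_plus_Int[of _ V _ W] S_subspace H_subspace) auto
  with Suc H_dim[of n] show ?case by (simp add: add.commute)
qed

text \<open>Every earlier \<open>H i\<close> lies in \<open>S n\<close>, so a functional vanishing
  on \<open>S n\<close> kills all earlier exterior powers.\<close>

lemma ext_step: "fs.dim (U n) + (r choose k) \<le> fs.dim (U (Suc n)) + (d n choose k)" if n: "n < t"
proof -
  obtain V where V: "H n \<subseteq> span V" "finite V" using H_finite[OF n] by auto
  obtain W where W: "U n \<subseteq> fs.span W" "finite W" using U_finite[of n] n by auto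
  have sub: "H i \<subseteq> S n" if "i < n" for i
  proof
    fix x assume "x \<in> H i"
    moreover have "0 \<in> H l" if "l < n" for l using H_subspace[of l] that n by (simp add: subspace_0)
    ultimately have "\<forall>l\<in>{..<n}. (if l = i then x else 0) \<in> H l" by auto
    moreover have "x = (\<Sum>l<n. if l = i then x else 0)" using that by simp
    ultimately show "x \<in> S n" unfolding set_sum_alt[OF finite_lessThan]
      by (intro CollectI exI[of _ "\<lambda>l. if l = i then x else 0"]) auto
  qed
  have "fs.dim (U n) + (dim (H n) choose k) \<le> fs.dim (U n + ext_power scale k (H n)) + (d n choose k)"
  proof (rule dim_add_ext_power_generic[OF _ H_subspace[OF n] V U_subspace W])
    show "subspace (S n)" using n by (intro S_subspace) auto
    fix f :: "('b list \<Rightarrow> 'a) \<Rightarrow> 'a" and \<psi>s :: "('b \<Rightarrow> 'a) list" and \<psi>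
    assume *: "f \<in> U n" "length \<psi>s = k" "\<psi> \<in> set \<psi>s" "\<And>x. x \<in> S n \<Longrightarrow> \<psi> x = 0"
    show "f (det_form k \<psi>s) = 0"
    proof (rule sum_ext_power_eval_eq_0[OF *(1,2)])
      show "\<exists>\<psi>\<in>set \<psi>s. \<forall>x\<in>H i. \<psi> x = 0" if "i < n" for i
        using *(3,4) sub[OF that] by (intro bexI[of _ \<psi>]) auto
    qed
  qed
  then show ?thesis using H_dim[OF n] by simp
qed

text \<open>For \<open>d j = r\<close> the generic step gains nothing. Here the earlier subspaces
  form a direct sum, and the gain comes from splitting it into \<open>H l\<close> and the sum
  \<open>Q\<close> of the others.\<close>

lemma ext_step_contained:
  assumes j: "j < t" "\<And>i. i < j \<Longrightarrow> d i = 0" "d j = r"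
  shows "fs.dim (U j) + (r - 1 choose (k - 1)) \<le> fs.dim (U (Suc j))"
proof -
  obtain V where V: "H j \<subseteq> span V" "finite V" using H_finite[OF j(1)] by auto
  obtain W where W: "U j \<subseteq> fs.span W" "finite W" using U_finite[of j] j(1) by auto
  have dir: "direct_sum j H"
  proof (rule direct_sum_if_Int)
    show "S i \<inter> H i \<subseteq> {0}" if "i < j" for i
      using Int_trivial_if[of i] j(1) j(2)[OF that] that by simp
  qed (use H_subspace j(1) in simp)
  \<comment> \<open>A non-zero \<open>v\<close> of \<open>H j\<close> has a non-zero component at
    some \<open>l\<close>; leaving out \<open>H l\<close> then excludes \<open>v\<close> from
    \<open>Q\<close>.\<close>
  have "\<not> H j \<subseteq> {0}"
    using H_dim[OF j(1)] k dim_le_card[of "H j" "{}"] by auto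
  then obtain v where v: "v \<in> H j" "v \<noteq> 0" by blast
  then have "v \<in> S j" using H_subset_if j by blast
  then obtain s where s: "v = sum s {..<j}" "\<forall>i\<in>{..<j}. s i \<in> H i"
    unfolding set_sum_alt[OF finite_lessThan] by blast
  have "\<exists>l<j. s l \<noteq> 0"
    using v(2) unfolding s(1) by (rule contrapos_np) (auto intro: sum.neutral)
  then obtain l where l: "l < j" "s l \<noteq> 0" by blast
  define Q where "Q = (\<Sum>i\<in>{..<j} - {l}. H i)"
  have "v \<notin> Q"
  proof
    assume "v \<in> Q"
    then obtain u where u: "v = sum u ({..<j} - {l})" "\<forall>i\<in>{..<j} - {l}. u i \<in> H i"
      unfolding Q_def by (auto simp: set_sum_alt)
    \<comment> \<open>Inside \<open>Q\<close>, \<open>v\<close> would have a second decomposition,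
      with component 0 at \<open>l\<close>.\<close>
    define w where "w i = (if i = l then 0 else u i)" for i
    have "sum w {..<j} = sum s {..<j}"
    proof -
      have "sum w {..<j} = w l + sum w ({..<j} - {l})" using l(1) by (simp add: sum.remove)
      also have "sum w ({..<j} - {l}) = sum u ({..<j} - {l})"
        by (rule sum.cong) (auto simp: w_def)
      finally show ?thesis using u(1) s(1) by (simp add: w_def)
    qed
    moreover have "\<forall>i<j. w i \<in> H i"
      using u(2) H_subspace j(1) by (auto simp: w_def subspace_0)
    ultimately have "w l = s l" using dir s(2) l(1) unfolding direct_sum_def by blast
    with l(2) show False by (simp add: w_def)
  qed
  have "fs.dim (U j) + (dim (H j) - 1 choose (k - 1)) \<le> fs.dim (U j + ext_power scale k (H j))"
  proof (rule dim_add_ext_power_in_direct_sum[where P = "H l" and Q = Q, OF _ V _ _ _ _ _ _ k(1) U_subspace W])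
    show "subspace (H j)" "subspace (H l)" using H_subspace j(1) l(1) by auto
    show "subspace Q" unfolding Q_def using j(1) by (intro S_subspace) auto
    show "2 \<le> dim (H j)" using H_dim j(1) k by simp
    have "Q \<inter> H l \<subseteq> {0}"
      unfolding Q_def by (rule direct_sum_imp_Int[OF dir]) (use H_subspace j(1) l(1) in auto)
    then show "H l \<inter> Q \<subseteq> {0}" by blast
    show "\<not> H j \<subseteq> Q" using v(1) \<open>v \<notin> Q\<close> by blast
    \<comment> \<open>Equal dimensions turn inclusion into equality, which the distinctness of the
      family forbids.\<close>
    show "\<not> H j \<subseteq> H l"
    proof
      assume sub: "H j \<subseteq> H l"
      obtain V' where V': "H l \<subseteq> span V'" "finite V'" using H_finite[of l] j(1) l(1) by auto
      have "H j \<inter> H l = H j" using sub by blast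
      then have "dim (H j \<inter> H l) = dim (H l)" using H_dim j(1) l(1) by simp
      then have "H l \<subseteq> H j"
        by (intro dim_Int_le(2)[OF _ _ V']) (use H_subspace j(1) l(1) in auto)
      with sub have "j = l" using H_inj j(1) l(1) by simp
      with l(1) show False by simp
    qed
    fix f :: "('b list \<Rightarrow> 'a) \<Rightarrow> 'a" and \<psi>s :: "('b \<Rightarrow> 'a) list" and \<psi> \<psi>'
    assume *: "f \<in> U j" "length \<psi>s = k" "\<psi> \<in> set \<psi>s" "\<psi>' \<in> set \<psi>s"
      "\<And>x. x \<in> H l \<Longrightarrow> \<psi> x = 0" "\<And>x. x \<in> Q \<Longrightarrow> \<psi>' x = 0"
    \<comment> \<open>Thus \<open>\<psi>'\<close> kills every earlier subspace except
      \<open>H l\<close>, which is killed by \<open>\<psi>\<close>.\<close>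
    have sub: "H i \<subseteq> Q" if "i < j" "i \<noteq> l" for i
    proof
      fix x assume "x \<in> H i"
      moreover have "0 \<in> H m" if "m < j" for m using H_subspace[of m] that j(1) by (simp add: subspace_0)
      ultimately have "\<forall>m\<in>{..<j} - {l}. (if m = i then x else 0) \<in> H m" by auto
      moreover have "x = (\<Sum>m\<in>{..<j} - {l}. if m = i then x else 0)" using that by simp
      ultimately show "x \<in> Q" unfolding Q_def
        by (subst set_sum_alt, simp) (intro CollectI exI[of _ "\<lambda>m. if m = i then x else 0"], auto)
    qed
    show "f (det_form k \<psi>s) = 0"
    proof (rule sum_ext_power_eval_eq_0[OF *(1,2)])
      show "\<exists>\<psi>\<in>set \<psi>s. \<forall>x\<in>H i. \<psi> x = 0" if "i < j" for i
      proof (cases "i = l")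
        case True
        then show ?thesis using *(3,5) by (intro bexI[of _ \<psi>]) auto
      next
        case False
        then show ?thesis using *(4,6) sub[OF that False] by (intro bexI[of _ \<psi>']) auto
      qed
    qed
  qed
  then show ?thesis using H_dim[OF j(1)] by simp
qed

lemma ext_dim_ge: "n * (r choose k) \<le> fs.dim (U n) + (\<Sum>i<n. d i choose k)" if "n \<le> t"
  using that
proof (induction n)
  case (Suc n)
  then show ?case using ext_step[of n] by simp
qed simp

text \<open>At step \<open>j\<close> the term \<open>d j choose k = r choose k\<close> alone
  balances the growth on the left. The gain of \<open>ext_step_contained\<close> is therefore pure
  surplus and survives the later steps.\<close>

lemma ext_dim_ge_contained:
  assumes j: "j < t" "\<And>i. i < j \<Longrightarrow> d i = 0" "d j = r" and "Suc j \<le> n" "n \<le> t"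
  shows "n * (r choose k) + (r - 1 choose (k - 1)) \<le> fs.dim (U n) + (\<Sum>i<n. d i choose k)"
  using assms(4,5)
proof (induction n rule: dec_induct)
  case base
  then show ?case using ext_step_contained[OF j] ext_dim_ge[of j] j(1,3) by simp
next
  case (step n)
  then show ?case using ext_step[of n] by simp
qed

lemma ord_dim_eq: "(\<Sum>i<t. d i) + ord_dim scale t H = t * r"
  using sum_d[of t] by (simp add: ord_dim_def)

text \<open>Convexity bounds the accumulated losses \<open>d i choose k\<close>. Subtracted terms
  stand on the other side to remain in \<open>nat\<close>.\<close>

lemma ext_dim_bound:
  assumes "t * r = ord_dim scale t H + a * r + b" "b < r"
  shows "t * (r choose k) \<le> ext_dim scale k t H + a * (r choose k) + (b choose k)"
proof -
  have "(\<Sum>i<t. d i choose k) \<le> a * (r choose k) + (b choose k)"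
    by (rule sum_binomial_le[of "{..<t}" k d r a b])
      (use k d_le ord_dim_eq assms in auto)
  then show ?thesis using ext_dim_ge[of t] by (simp add: ext_dim_def)
qed

text \<open>A value \<open>d j\<close> strictly between 0 and \<open>r\<close> leaves slack in the
  convexity estimate; otherwise the surplus arises at the first \<open>j\<close> with
  \<open>d j = r\<close>.\<close>

lemma ext_dim_bound_multiple:
  assumes "t * r = ord_dim scale t H + a * r" "0 < a"
  shows "t * (r choose k) + (r - 1 choose (k - 1)) \<le> ext_dim scale k t H + a * (r choose k)"
proof (cases "\<exists>j<t. 0 < d j \<and> d j < r")
  case True
  then obtain j where "j < t" "0 < d j" "d j < r" by blast
  then have "(\<Sum>i<t. d i choose k) + (r - 1 choose (k - 1)) \<le> a * (r choose k)"
    by (intro sum_binomial_le_strict[of _ _ _ _ _ j]) (use k d_le ord_dim_eq assms(1) in auto)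
  then show ?thesis using ext_dim_ge[of t] by (simp add: ext_dim_def)
next
  case False
  have sum: "(\<Sum>i<t. d i) = a * r" using ord_dim_eq assms(1) by simp
  then have "(\<Sum>i<t. d i) \<noteq> 0" using assms(2) k by simp
  then have ex: "\<exists>j. j < t \<and> d j \<noteq> 0"
    by (rule contrapos_np) (auto intro: sum.neutral)
  \<comment> \<open>Minimality makes all earlier \<open>d i\<close> zero, so that
    \<open>ext_dim_ge_contained\<close> applies.\<close>
  define j where "j = (LEAST j. j < t \<and> d j \<noteq> 0)"
  have j: "j < t" "d j \<noteq> 0" using LeastI_ex[OF ex] by (auto simp: j_def)
  have "d i = 0" if "i < j" for i
    using not_less_Least[of i "\<lambda>j. j < t \<and> d j \<noteq> 0"] that j(1) by (auto simp: j_def)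
  moreover have "d j = r" using False j d_le[of j] by force
  ultimately have "t * (r choose k) + (r - 1 choose (k - 1)) \<le> fs.dim (U t) + (\<Sum>i<t. d i choose k)"
    using j(1) by (intro ext_dim_ge_contained[of j]) auto
  moreover have "(\<Sum>i<t. d i choose k) \<le> a * (r choose k) + (0 choose k)"
    by (rule sum_binomial_le[of "{..<t}" k d r a 0]) (use k d_le sum in auto)
  ultimately show ?thesis using k by (simp add: ext_dim_def binomial_eq_0)
qed

text \<open>Subadditivity of dimension. It serves the two equality claims, for direct sums and for
  the extremal example.\<close>

lemma ext_dim_le: "ext_dim scale k t H \<le> t * (r choose k)"
proof -
  have "fs.dim (U t) \<le> (\<Sum>i<t. fs.dim (ext_power scale k (H i)))"
    by (intro fs.dim_sum_sets_le subspace_ext_power ext_power_H_finite)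
  also have "\<dots> \<le> (\<Sum>i<t. r choose k)"
  proof (rule sum_mono)
    fix i assume "i \<in> {..<t}"
    then have i: "i < t" by simp
    obtain W where W: "H i \<subseteq> span W" "finite W" using H_finite[OF i] by auto
    obtain B where B: "finite B" "B \<subseteq> H i" "independent B" "H i \<subseteq> span B" "card B = dim (H i)"
      by (rule finite_basis_exists[OF W])
    have "span B = H i" using B H_subspace[OF i] by (simp add: span_subspace)
    then show "fs.dim (ext_power scale k (H i)) \<le> (r choose k)"
      using dim_ext_power_span_le[OF B(1), of k] B(5) H_dim[OF i] by simp
  qed
  finally show ?thesis by (simp add: ext_dim_def)
qed

text \<open>Both sides say that every \<open>d i\<close> vanishes.\<close>

lemma direct_sum_iff: "direct_sum t H \<longleftrightarrow> ord_dim scale t H = t * r"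
proof
  assume dir: "direct_sum t H"
  have "d i = 0" if "i < t" for i
  proof -
    have "S i \<inter> H i \<subseteq> {0}"
      by (rule direct_sum_imp_Int[OF dir H_subspace]) (use that in auto)
    then show ?thesis using dim_le_card[of "S i \<inter> H i" "{}"] by simp
  qed
  then show "ord_dim scale t H = t * r" using ord_dim_eq by simp
next
  assume "ord_dim scale t H = t * r"
  then have "d i = 0" if "i < t" for i using ord_dim_eq that by simp
  then show "direct_sum t H"
    by (intro direct_sum_if_Int H_subspace) (simp_all add: Int_trivial_if)
qed

text \<open>Multiplication by \<open>r\<close> avoids fractions. With quotient \<open>a\<close> and
  remainder \<open>b\<close>, (t - a) C(r,k) is \<beta> times O + b. If \<open>b = 0\<close>, the
  extra term is worth one unit of \<beta>; otherwise \<open>b choose k\<close> consumes at most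
  \<open>b - 1\<close> of the \<open>b\<close> units.\<close>

lemma ext_dim_gap:
  assumes "\<not> direct_sum t H"
  shows "(ord_dim scale t H + 1) * (r choose k) \<le> r * ext_dim scale k t H"
proof -
  let ?O = "ord_dim scale t H" and ?E = "ext_dim scale k t H" and ?C = "r choose k"
  define f where "f = (\<Sum>i<t. d i)"
  define a b where "a = f div r" and "b = f mod r"
  have f: "f = a * r + b" "b < r" using k by (auto simp: a_def b_def)
  have O: "t * r = ?O + a * r + b" using ord_dim_eq f(1) by (simp add: f_def)
  have "f \<noteq> 0"
  proof
    assume "f = 0"
    then have "direct_sum t H" using direct_sum_iff ord_dim_eq by (simp add: f_def)
    with assms show False ..
  qed
  show ?thesis
  proof (cases "b = 0")
    case True
    then have "0 < a" using f \<open>f \<noteq> 0\<close> by (cases a) auto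
    with True O have "t * ?C + (r - 1 choose (k - 1)) \<le> ?E + a * ?C"
      by (intro ext_dim_bound_multiple) auto
    then have "r * (t * ?C + (r - 1 choose (k - 1))) \<le> r * (?E + a * ?C)" by (rule mult_left_mono) simp
    moreover have "?C \<le> r * (r - 1 choose (k - 1))" using k by (intro binomial_le_mult_pred) simp
    moreover have "r * (t * ?C) = ?O * ?C + r * (a * ?C)"
      using arg_cong[OF O, of "\<lambda>x. x * ?C"] True by (simp add: algebra_simps)
    ultimately show ?thesis by (simp add: distrib_left distrib_right)
  next
    case False
    have "t * ?C \<le> ?E + a * ?C + (b choose k)" by (rule ext_dim_bound[OF O f(2)])
    then have "r * (t * ?C) \<le> r * (?E + a * ?C + (b choose k))" by (rule mult_left_mono) simp
    moreover have "(b choose k) * r \<le> (b - 1) * ?C" using k f(2) by (intro binomial_secant_le)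
    moreover have "r * (t * ?C) = ?O * ?C + r * (a * ?C) + b * ?C"
      using arg_cong[OF O, of "\<lambda>x. x * ?C"] by (simp add: algebra_simps)
    moreover have "b * ?C = (b - 1) * ?C + ?C" using False by (cases b) auto
    ultimately show ?thesis by (simp add: distrib_left distrib_right mult.commute)
  qed
qed

end

section \<open>The bounds in real arithmetic\<close>

lemma (in equidim_family) dimension_bounds:
  defines "Od \<equiv> ord_dim scale t H" and "Ed \<equiv> ext_dim scale k t H"
    and "\<beta> \<equiv> 1 / real r * real (r choose k)" and "\<Phi> \<equiv> int (t * r) - int (ord_dim scale t H)"
  shows "0 \<le> \<Phi>"
    and "\<Phi> = int (a * r + b) \<Longrightarrow> b < r \<Longrightarrow>
      real Ed \<ge> (real t - real a) * real (r choose k) - real (b choose k)"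
    and "\<Phi> = int (a * r + b) \<Longrightarrow> \<Phi> > 0 \<Longrightarrow> b = 0 \<Longrightarrow>
      real Ed \<ge> (real t - real a) * real (r choose k) + real ((r - 1) choose (k - 1))"
    and "\<not> direct_sum t H \<Longrightarrow> real Ed \<ge> \<beta> * (real Od + 1)"
    and "real Ed \<ge> \<beta> * real Od"
    and "real Ed = \<beta> * real Od \<longleftrightarrow> direct_sum t H"
proof -
  have r: "0 < r" using k by simp
  have C: "0 < (r choose k)" using k by simp
  show "0 \<le> \<Phi>" using ord_dim_eq by (simp add: \<Phi>_def flip: of_nat_add of_nat_mult)
  have split: "t * r = ord_dim scale t H + a * r + b" if "\<Phi> = int (a * r + b)" for a b
    using that unfolding \<Phi>_def by linarith
  show "real Ed \<ge> (real t - real a) * real (r choose k) - real (b choose k)"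
    if "\<Phi> = int (a * r + b)" "b < r" for a b
    using of_nat_mono[OF ext_dim_bound[OF split[OF that(1)] that(2)], where 'a = real]
    by (simp add: Ed_def algebra_simps)
  show "real Ed \<ge> (real t - real a) * real (r choose k) + real ((r - 1) choose (k - 1))"
    if "\<Phi> = int (a * r + b)" "\<Phi> > 0" "b = 0" for a b
  proof -
    have "0 < a" using that by (cases a) auto
    with split[OF that(1)] that(3)
    have "t * (r choose k) + (r - 1 choose (k - 1)) \<le> ext_dim scale k t H + a * (r choose k)"
      by (intro ext_dim_bound_multiple) auto
    from of_nat_mono[OF this, where 'a = real] show ?thesis by (simp add: Ed_def algebra_simps)
  qed
  show gap: "real Ed \<ge> \<beta> * (real Od + 1)" if "\<not> direct_sum t H"
    using of_nat_mono[OF ext_dim_gap[OF that], where 'a = real] r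
    by (simp add: Ed_def Od_def \<beta>_def field_simps)
  have eq: "real Ed = \<beta> * real Od" if "direct_sum t H"
  proof -
    have Od: "Od = t * r" using that direct_sum_iff by (simp add: Od_def)
    \<comment> \<open>For a direct sum \<Phi> is 0, so the first bound with \<open>a = b = 0\<close>
      meets the upper bound \<open>ext_dim_le\<close>.\<close>
    have "t * (r choose k) \<le> Ed + 0 * (r choose k) + (0 choose k)"
      unfolding Ed_def by (rule ext_dim_bound) (use Od r in \<open>simp_all add: Od_def\<close>)
    then have "Ed = t * (r choose k)" using ext_dim_le k by (simp add: Ed_def binomial_eq_0)
    then show ?thesis using Od r by (simp add: \<beta>_def)
  qed
  \<comment> \<open>Positivity of \<beta> turns the one-unit gap into strict inequality, so equality
    forces directness.\<close>
  have "\<beta> > 0" using r C by (simp add: \<beta>_def)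
  then have strict: "real Ed > \<beta> * real Od" if "\<not> direct_sum t H"
    using gap[OF that] by (simp add: distrib_left)
  show "real Ed \<ge> \<beta> * real Od" using eq strict by (cases "direct_sum t H") auto
  show "real Ed = \<beta> * real Od \<longleftrightarrow> direct_sum t H" using eq strict less_irrefl by metis
qed

section \<open>Sharpness of the one-unit gap\<close>

text \<open>The two blocks of \<open>r\<close> coordinates share exactly the coordinate
  \<open>r - 1\<close>, which makes \<Phi> equal to 1.\<close>

lemma two_coordinate_subspaces:
  fixes k r :: nat
  assumes k: "2 \<le> k" "k \<le> r"
  defines "e \<equiv> (\<lambda>i x. if x = i then 1 else 0) :: nat \<Rightarrow> nat \<Rightarrow> 'f::field"
  defines "H \<equiv> \<lambda>i. fs.span (e ` {i * (r - 1)..<i * (r - 1) + r})"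
  shows "subspace_family fun_scale r 2 H" "ord_dim fun_scale 2 H = 2 * r - 1"
proof -
  \<comment> \<open>Unit vectors are dual to the evaluations at their indices.\<close>
  have ind: "inj_on e I" "fs.independent (e ` I)" if "finite I" for I
    using fs_independent_of_dual(1,2)[OF that, of e "\<lambda>i. i"] by (auto simp: e_def)
  have dim: "fs.dim (e ` I) = card I" if "finite I" for I
    using fs.dim_eq_card_independent[OF ind(2)[OF that]] card_image[OF ind(1)[OF that]] by simp
  have "H 0 \<noteq> H 1"
  proof
    assume eq: "H 0 = H 1"
    have "e 0 \<in> H 0" unfolding H_def by (rule fs.span_base) (use k in auto)
    \<comment> \<open>The second block starts at \<open>r - 1\<close>, which is positive.\<close>
    moreover have "H 1 \<subseteq> {f. f 0 = 0}"
      unfolding H_def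
      by (intro fs.span_minimal) (use k in \<open>auto simp: e_def fun_scale_def intro!: fs.subspaceI\<close>)
    ultimately show False using eq by (auto simp: e_def)
  qed
  then have "inj_on H {..<2}" by (auto simp: inj_on_def numeral_2_eq_2 less_Suc_eq)
  moreover have "fs.dim (H i) = r" for i unfolding H_def by (simp add: dim)
  ultimately show "subspace_family fun_scale r 2 H"
    by (auto simp: subspace_family_def H_def)
  have "(\<Sum>i<2. H i) = H 0 + H 1" by (simp add: numeral_2_eq_2)
  also have "\<dots> = fs.span (e ` {0..<r} \<union> e ` {r - 1..<2 * r - 1})"
    using k unfolding fs.span_Un H_def by (simp add: set_plus_def mult_2) blast
  also have "e ` {0..<r} \<union> e ` {r - 1..<2 * r - 1} = e ` {0..<2 * r - 1}"
    unfolding image_Un[symmetric] using k by (intro arg_cong[where f = "(`) e"]) auto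
  finally show "ord_dim fun_scale 2 H = 2 * r - 1"
    by (simp add: ord_dim_def dim)
qed

theorem theorem3p3:
  fixes scale :: "'f::field \<Rightarrow> 'v::ab_group_add \<Rightarrow> 'v"
    and k r :: nat
  assumes "vector_space scale"
    and "2 \<le> k" and "k \<le> r"
  shows
    "let \<beta> = 1 / real r * real (r choose k) in
     (\<forall>t H. subspace_family scale r t H \<longrightarrow>
       (let Od = ord_dim scale t H;
            Ed = ext_dim scale k t H;
            \<Phi> = int (t * r) - int Od
        in 0 \<le> \<Phi> \<and>
           (\<forall>a b :: nat. \<Phi> = int (a * r + b) \<and> b < r \<longrightarrow>
              real Ed \<ge> (real t - real a) * real (r choose k) - real (b choose k) \<and>
              (\<Phi> > 0 \<and> b = 0 \<longrightarrow>
                real Ed \<ge> (real t - real a) * real (r choose k) + real ((r - 1) choose (k - 1)))) \<and>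
           real Ed \<ge> \<beta> * real Od \<and>
           (\<not> direct_sum t H \<longrightarrow> real Ed \<ge> \<beta> * (real Od + 1)) \<and>
           (real Ed = \<beta> * real Od \<longleftrightarrow> direct_sum t H)))
     \<and> (\<exists>t (H :: nat \<Rightarrow> (nat \<Rightarrow> 'f) set).
          subspace_family fun_scale r t H \<and> \<not> direct_sum t H \<and>
          real (ext_dim fun_scale k t H) = \<beta> * (real (ord_dim fun_scale t H) + 1))"
proof -
  have fam: "equidim_family scale k r t H" if "subspace_family scale r t H" for t H
    using assms that by (intro equidim_family.intro equidim_family_axioms.intro)
  obtain H :: "nat \<Rightarrow> (nat \<Rightarrow> 'f) set"
    where H: "subspace_family fun_scale r 2 H" "ord_dim fun_scale 2 H = 2 * r - 1"
    using two_coordinate_subspaces[OF assms(2,3)] by blast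
  interpret ex: equidim_family fun_scale k r 2 H
    by (intro equidim_family.intro equidim_family_axioms.intro vector_space_fun_scale assms(2,3) H(1))
  have "\<not> direct_sum 2 H" using ex.direct_sum_iff H(2) assms by simp
  \<comment> \<open>Here \<open>a = 0\<close> and \<open>b = 1\<close>, and the loss
    \<open>1 choose k\<close> is 0 because \<open>2 \<le> k\<close>. The dimension is thus the full
    \<open>2 * (r choose k)\<close>, which is \<beta> times \<open>2 * r\<close>.\<close>
  moreover have "2 * (r choose k) \<le> ext_dim fun_scale k 2 H + 0 * (r choose k) + (1 choose k)"
    by (rule ex.ext_dim_bound) (use H(2) assms in auto)
  then have "ext_dim fun_scale k 2 H = 2 * (r choose k)"
    using ex.ext_dim_le assms by (simp add: binomial_eq_0)
  then have "real (ext_dim fun_scale k 2 H) =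
      1 / real r * real (r choose k) * (real (ord_dim fun_scale 2 H) + 1)"
    using H(2) assms by simp
  ultimately have "\<exists>t (H :: nat \<Rightarrow> (nat \<Rightarrow> 'f) set).
      subspace_family fun_scale r t H \<and> \<not> direct_sum t H \<and>
      real (ext_dim fun_scale k t H) =
        1 / real r * real (r choose k) * (real (ord_dim fun_scale t H) + 1)"
    using H(1) by blast
  then show ?thesis
    unfolding Let_def using equidim_family.dimension_bounds[OF fam] by (intro conjI allI impI; (elim conjE)?) blast+
qed

end
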